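(* Let $D'(x)=\#\{1\le n\le x : n \text{ is strictly } 2\text{-dense}\}$. There is a constant $c>0$ such that $D'(x)\ge c\,\dfrac{x}{\log x}$ for all real $x\ge 2$.
   Context: For a positive integer $n$ let $1=d_1<d_2<\cdots<d_{\tau(n)}=n$ be its positive divisors in increasing order, where $\tau(n)$ is the number of divisors. A squarefree integer $n$ is strictly $2$-dense if $d_{i+1}/d_i<2$ for all $i$ with $1<i<\tau(n)-1$, and $d_2/d_1=2=d_{\tau(n)}/d_{\tau(n)-1}$ (in particular $n$ is even). *)

theory Defs
  imports Complex_Main "HOL-Computational_Algebra.Squarefree"
begin

definition tau :: "nat \<Rightarrow> nat" where
  "tau n = card {d. d dvd n}"

(* The divisors are indexed from 1, so that nth_divisor n 1 = 1 and
   nth_divisor n (tau n) = n; only 1 \<le> i \<le> tau n is meaningful. *)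
definition nth_divisor :: "nat \<Rightarrow> nat \<Rightarrow> nat" where
  "nth_divisor n i = sorted_list_of_set {d. d dvd n} ! (i - 1)"

(* The condition n > 1 is implicit in the mention of the second divisor. *)
definition strictly_2_dense :: "nat \<Rightarrow> bool" where
  "strictly_2_dense n \<longleftrightarrow>
     n > 1 \<and> squarefree n \<and>
     (\<forall>i. 1 < i \<and> i < tau n - 1 \<longrightarrow>
        real (nth_divisor n (i + 1)) / real (nth_divisor n i) < 2) \<and>
     real (nth_divisor n 2) / real (nth_divisor n 1) = 2 \<and>
     real (nth_divisor n (tau n)) / real (nth_divisor n (tau n - 1)) = 2"

definition D' :: "real \<Rightarrow> nat" where
  "D' x = card {n::nat. 1 \<le> n \<and> real n \<le> x \<and> strictly_2_dense n}"

end

theory Submission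
  imports Defs "HOL-Number_Theory.Prime_Powers"
begin

text \<open>Multiplying a strictly 2-dense number \<open>m > 2\<close> by a prime \<open>p < m\<close> not dividing it
  keeps it strictly 2-dense. Start from a primorial \<open>N\<close> and attach larger primes in increasing
  order, each at most \<open>N\<close> times the product \<open>n\<close> of those attached before. If every prime \<open>p\<close> is
  attached with probability \<open>p\<^sup>-\<^sup>s / (1 + p\<^sup>-\<^sup>s)\<close>, \<open>s = 1 + e\<close>, then optional stopping for the
  martingale obtained by centring \<open>log n\<close> is an exact identity for sums over the numbers
  produced. With Mertens' first theorem it says that the mean of
  \<open>log n - (1 - n\<^sup>-\<^sup>e) / e\<close> is bounded above, and also bounded below because \<open>N\<close> is large.
  Comparing different \<open>e\<close> shows that the contributions of \<open>log n\<close> much smaller or much larger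
  than \<open>1 / e\<close> are negligible, so the sum of \<open>1 / n\<close> over the strictly 2-dense
  \<open>n \<in> [x\<^sup>a, x\<^sup>b]\<close> stays bounded below. Boundedly many further prime factors spread this
  logarithmic density to all products up to \<open>x\<close>.\<close>

section \<open>Strictly 2-dense numbers\<close>

text \<open>Write L = log n. The excess L - (1 - exp(-eL))/e behaves like eL^2/2 below the scale 1/e
  and like L - 1/e above it, while its mean is bounded uniformly in e. Comparing e with a larger e'
  shows that values L below 1/e' contribute at most a multiple of e/e'; comparing e with e/2 shows
  that values beyond K/e contribute at most a multiple of exp(-K/2). Bounds for one mean thus
  localise L at scale 1/e, with no sieve and no integral equation. The mean is bounded below because
  the process overshoots: it stops at N n instead of n, which gains n^(-e) (1 - N^(-e))/e, about log
  N times n^(-e). This has to beat an error log y0 + 8, mostly due to the missing primes up to y0. A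
  primorial N achieves it, its logarithm being at least a constant multiple of y0. Reciprocal sums
  alone give no count up to x. The count comes from a last prime p of size about x/n, which requires
  n > x^(1/2) for p < n, and n <= x^(97/100) so that p exceeds a fixed power of x and a product has
  boundedly many representations. Hence the window must be moved from small powers of x into this
  range.\<close>

definition densely_divisible :: "nat \<Rightarrow> bool" where
  "densely_divisible n \<longleftrightarrow> n > 1 \<and> squarefree n \<and> even n \<and>
     (\<forall>d. d dvd n \<longrightarrow> 2 \<le> d \<longrightarrow> 2 * d < n \<longrightarrow> (\<exists>d'. d' dvd n \<and> d < d' \<and> d' < 2 * d))"

text \<open>For even n the divisors excluded by \<open>2 \<le> d\<close> and
  \<open>2 * d < n\<close> are exactly 1, n/2 and n. What remains are the divisors with index
  strictly between 1 and \<open>tau n - 1\<close>, so the index-free condition controls the same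
  gaps.\<close>

lemma strictly_2_dense_if_densely_divisible:
  assumes "densely_divisible n"
  shows "strictly_2_dense n"
proof -
  from assms have n: "n > 1" "squarefree n" "even n"
    and gap: "\<And>d. d dvd n \<Longrightarrow> 2 \<le> d \<Longrightarrow> 2 * d < n \<Longrightarrow> \<exists>d'. d' dvd n \<and> d < d' \<and> d' < 2 * d"
    unfolding densely_divisible_def by blast+
  define D where "D = {d. d dvd n}"
  have finD: "finite D" using n by (simp add: D_def)
  define xs where "xs = sorted_list_of_set D"
  have set_xs: "set xs = D" and xs_sorted: "sorted_wrt (<) xs" and len_card: "length xs = card D"
    using finD by (simp_all add: xs_def)
  have tau: "tau n = length xs" by (simp add: tau_def len_card D_def)
  have nth: "nth_divisor n i = xs ! (i - 1)" for i
    by (simp add: nth_divisor_def xs_def D_def)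
  have mono: "xs ! i < xs ! j" if "i < j" "j < length xs" for i j
    using xs_sorted that by (simp add: sorted_wrt_iff_nth_less)
  have mono_le: "xs ! i \<le> xs ! j" if "i \<le> j" "j < length xs" for i j
    using mono[of i j] that by (cases "i = j") auto
  have index: "\<exists>j<length xs. xs ! j = d" if "d dvd n" for d
    using that set_xs by (metis D_def in_set_conv_nth mem_Collect_eq)
  have dvd: "xs ! i dvd n" if "i < length xs" for i
    using that set_xs nth_mem[of i xs] by (auto simp: D_def)
  have pos: "xs ! i > 0" if "i < length xs" for i
    using dvd[OF that] n by (auto intro: Nat.gr0I)
  have "card {1, n} \<le> card D" using finD n by (intro card_mono) (auto simp: D_def)
  with n have len: "length xs \<ge> 2" by (simp add: len_card)
  define t where "t = length xs"
  have first: "xs ! 0 = 1"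
  proof -
    obtain j where "j < length xs" "xs ! j = 1" using index[of 1] by auto
    with mono_le[of 0 j] pos[of 0] len show ?thesis by fastforce
  qed
  have last: "xs ! (t - 1) = n"
  proof -
    obtain j where "j < length xs" "xs ! j = n" using index[of n] by auto
    then have "n \<le> xs ! (t - 1)" using mono_le[of j "t - 1"] by (auto simp: t_def)
    moreover have "xs ! (t - 1) dvd n" using dvd[of "t - 1"] len by (auto simp: t_def)
    ultimately show ?thesis using n by (auto dest: dvd_imp_le)
  qed
  have second: "xs ! 1 = 2"
  proof -
    obtain j where j: "j < length xs" "xs ! j = 2" using index[of 2] n by auto
    then have "j \<noteq> 0" using first by (intro notI) simp
    then have "xs ! 1 \<le> 2" using mono_le[of 1 j] j by simp
    moreover have "xs ! 0 < xs ! 1" using mono[of 0 1] len by simp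
    ultimately show ?thesis using first by simp
  qed
  have penult: "2 * xs ! (t - 2) = n"
  proof -
    have "n div 2 dvd n" using n by (metis dvd_div_mult_self dvd_triv_left)
    then obtain j where j: "j < length xs" "xs ! j = n div 2" using index[of "n div 2"] by auto
    have "n div 2 < n" using n by simp
    then have "j \<noteq> t - 1" using j last by auto
    then have "n div 2 \<le> xs ! (t - 2)" using mono_le[of j "t - 2"] j len by (auto simp: t_def)
    moreover have lt: "xs ! (t - 2) < n" using mono[of "t - 2" "t - 1"] last len by (simp add: t_def)
    moreover have "xs ! (t - 2) \<le> n div 2"
    proof -
      obtain k where k: "n = xs ! (t - 2) * k"
        using dvd[of "t - 2"] len by (force simp: t_def elim: dvdE)
      have "k \<noteq> 0" "k \<noteq> 1" using lt n k by (intro notI; simp)+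
      then have "xs ! (t - 2) * 2 \<le> xs ! (t - 2) * k" by (intro mult_left_mono) auto
      then have "xs ! (t - 2) * 2 \<le> n" using k by simp
      then show ?thesis by simp
    qed
    ultimately show ?thesis using n by auto
  qed
  show ?thesis unfolding strictly_2_dense_def
  proof (intro conjI allI impI)
    fix i assume i: "1 < i \<and> i < tau n - 1"
    have il: "i < length xs" "i - 1 < length xs" using i by (auto simp: tau)
    have "xs ! 1 \<le> xs ! (i - 1)" by (intro mono_le) (use i il in auto)
    then have ge: "2 \<le> xs ! (i - 1)" using second by simp
    have "xs ! (i - 1) < xs ! (t - 2)" using i mono[of "i - 1" "t - 2"] by (auto simp: tau t_def)
    then have "2 * xs ! (i - 1) < n" using penult by simp
    with gap[OF dvd[OF il(2)] ge] obtain d' where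
      d': "d' dvd n" "xs ! (i - 1) < d'" "d' < 2 * xs ! (i - 1)" by blast
    obtain j where j: "j < length xs" "xs ! j = d'" using index[OF d'(1)] by auto
    \<comment> \<open>\<open>d'\<close> need not be the divisor following
      \<open>xs ! (i - 1)\<close>, but that divisor is \<open>xs ! i\<close> and cannot exceed
      \<open>d'\<close>.\<close>
    have "i \<le> j"
    proof (rule ccontr)
      assume "\<not> i \<le> j"
      then have "xs ! j \<le> xs ! (i - 1)" using mono_le[of j "i - 1"] il by simp
      with d' j show False by simp
    qed
    then have "xs ! i < 2 * xs ! (i - 1)" using mono_le[of i j] j d' by simp
    then have "real (xs ! i) < 2 * real (xs ! (i - 1))"
      by (metis of_nat_less_iff of_nat_mult of_nat_numeral)
    then show "real (nth_divisor n (i + 1)) / real (nth_divisor n i) < 2"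
      using ge by (simp add: nth divide_less_eq)
  next
    have "real (2 * xs ! (t - 2)) = real n" using penult by simp
    moreover have "xs ! (t - 2) > 0" using penult n by (intro Nat.gr0I) simp
    ultimately show "real (nth_divisor n (tau n)) / real (nth_divisor n (tau n - 1)) = 2"
      using last by (simp add: nth tau flip: t_def) (simp add: divide_eq_eq numeral_2_eq_2)
  qed (use n first second in \<open>simp_all add: nth\<close>)
qed

lemma densely_divisible_2: "densely_divisible 2"
  by (auto simp: densely_divisible_def intro: squarefree_prime)

lemma squarefree_6: "squarefree (6::nat)"
proof -
  have "squarefree ((2::nat) * 3)"
    by (intro squarefree_mult_coprime squarefree_prime)
      (simp_all add: primes_coprime)
  then show ?thesis by simp
qed

lemma densely_divisible_6: "densely_divisible 6"
proof -
  have "\<exists>d'. d' dvd 6 \<and> d < d' \<and> d' < 2 * d" if "2 \<le> d" "2 * d < 6" for d :: nat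
  proof -
    have "d = 2" using that by simp
    then show ?thesis by (intro exI[of _ 3]) auto
  qed
  then show ?thesis by (auto simp: densely_divisible_def squarefree_6)
qed

text \<open>Most gaps come from n: unscaled for divisors of n below n/2, scaled by p for p f with f
  at least 2. Only the gaps after p, n/2 and n are new. If 2p < n, a divisor of n between p and 2p
  fills the first, and p times the cofactor of a divisor next to p fills the other two; if 2p > n,
  the numbers n, p and 2p fill them.\<close>

lemma densely_divisible_mult_prime:
  assumes n: "densely_divisible n" and p: "prime p" "\<not> p dvd n" "p < n"
  shows "densely_divisible (n * p)"
proof -
  from n have n1: "n > 1" "squarefree n" "even n"
    and gap: "\<And>d. d dvd n \<Longrightarrow> 2 \<le> d \<Longrightarrow> 2 * d < n \<Longrightarrow> \<exists>d'. d' dvd n \<and> d < d' \<and> d' < 2 * d"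
    unfolding densely_divisible_def by blast+
  have cop: "coprime n p" using p by (metis coprime_commute prime_imp_coprime)
  have sf: "squarefree (n * p)"
    using n1 p cop squarefree_mult_coprime squarefree_prime by blast
  have p3: "p \<ge> 3" using p n1 prime_ge_2_nat[of p] by (cases "p = 2") auto
  have ne: "2 * p \<noteq> n" using p by auto
  \<comment> \<open>The divisors of \<open>n\<close> next to \<open>p\<close> on either side; their cofactors fill the gaps around \<open>n\<close>.\<close>
  have around: "\<exists>l u. l dvd n \<and> u dvd n \<and> p < 2 * l \<and> l < p \<and> p < u \<and> u < 2 * p" if lt: "2 * p < n"
  proof -
    define l where "l = Max {d. d dvd n \<and> d < p}"
    have fin: "finite {d. d dvd n \<and> d < p}" by auto
    have "2 \<in> {d. d dvd n \<and> d < p}" using n1 p3 by auto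
    then have "l \<in> {d. d dvd n \<and> d < p}" and l2: "2 \<le> l"
      unfolding l_def using Max_in[OF fin] Max_ge[OF fin] by (blast, blast)
    then have l: "l dvd n" "l < p" by auto
    have "2 * l < n" using l lt by simp
    from gap[OF l(1) l2 this] obtain u where u: "u dvd n" "l < u" "u < 2 * l" by blast
    have "\<not> u < p"
    proof
      assume "u < p"
      then have "u \<le> l" unfolding l_def using fin u by (intro Max_ge) auto
      with u show False by simp
    qed
    moreover have "u \<noteq> p" using u p by auto
    ultimately have "p < u" by simp
    with u l show ?thesis by (intro exI[of _ l] exI[of _ u]) auto
  qed
  have cofactor: "\<exists>v. v * e = n \<and> v * p dvd n * p" if "e dvd n" for e
    using that by (metis dvd_div_mult_self dvd_triv_left mult_dvd_mono dvd_refl)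
  have "\<exists>d'. d' dvd n * p \<and> d < d' \<and> d' < 2 * d" if d: "d dvd n * p" "2 \<le> d" "2 * d < n * p" for d
  proof (cases "p dvd d")
    case True
    then obtain f where f: "d = p * f" by (auto simp: dvd_def)
    with d p have fn: "f dvd n" "2 * f < n" by (auto simp: mult.commute)
    show ?thesis
    proof (cases "f \<ge> 2")
      case True
      with gap fn obtain f' where "f' dvd n" "f < f'" "f' < 2 * f" by blast
      then show ?thesis using f p3 by (intro exI[of _ "f' * p"]) auto
    next
      case False
      have "f \<noteq> 0" using d f by auto
      with False have "f = 1" by simp
      with f have dp: "d = p" by simp
      show ?thesis
      proof (cases "2 * p < n")
        case True
        with around obtain u where "u dvd n" "p < u" "u < 2 * p" by blast
        then show ?thesis using dp by (intro exI[of _ u]) auto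
      next
        case False
        then show ?thesis using dp ne p by (intro exI[of _ n]) auto
      qed
    qed
  next
    case False
    then have dn: "d dvd n" using d p
      by (metis coprime_commute coprime_dvd_mult_left_iff prime_imp_coprime)
    then obtain k where k: "n = d * k" by (auto simp: dvd_def)
    consider "2 * d < n" | "n = 2 * d" | "n = d"
    proof -
      have "k \<noteq> 0" using k n1 by (intro notI) simp
      then consider "k = 1" | "k = 2" | "k \<ge> 3" by linarith
      then show thesis using that k d by cases (auto simp: mult.commute)
    qed
    then show ?thesis
    proof cases
      case 1
      with gap dn d show ?thesis by (meson dvd_mult2)
    next
      case 2
      show ?thesis
      proof (cases "2 * p < n")
        case True
        with around obtain u where u: "u dvd n" "p < u" "u < 2 * p" by blast
        obtain v where v: "v * u = n" "v * p dvd n * p" using cofactor[OF u(1)] by auto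
        have "v > 0" using v(1) n1 by (intro Nat.gr0I) simp
        then have "v * p < v * u" "v * u < v * (2 * p)" using u by simp_all
        then show ?thesis using 2 v by (intro exI[of _ "v * p"]) auto
      next
        case False
        then show ?thesis using 2 ne p by (intro exI[of _ p]) auto
      qed
    next
      case 3
      show ?thesis
      proof (cases "2 * p < n")
        case True
        with around obtain l where u: "l dvd n" "p < 2 * l" "l < p" by blast
        obtain v where v: "v * l = n" "v * p dvd n * p" using cofactor[OF u(1)] by auto
        have "v > 0" using v(1) n1 by (intro Nat.gr0I) simp
        then have "v * l < v * p" "v * p < v * (2 * l)" using u by simp_all
        then show ?thesis using 3 v by (intro exI[of _ "v * p"]) auto
      next
        case False
        then show ?thesis using 3 ne p n1
          by (intro exI[of _ "2 * p"]) (auto intro: mult_dvd_mono)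
      qed
    qed
  qed
  moreover have "1 < n * p" using n1 p3 by (metis less_1_mult less_le_trans one_less_numeral_iff semiring_norm(77))
  ultimately show ?thesis using sf n1 by (simp add: densely_divisible_def)
qed

section \<open>Mertens' theorem with a damping factor\<close>

lemma finite_primes_le [simp]: "finite {p::nat. prime p \<and> p \<le> n}"
  by (rule finite_subset[of _ "{..n}"]) auto

lemma primes_le_Suc:
  "{p. prime p \<and> p \<le> Suc n} =
     (if prime (Suc n) then insert (Suc n) {p. prime p \<and> p \<le> n} else {p. prime p \<and> p \<le> n})"
  by (auto simp: le_Suc_eq)

lemma prod_primes_dvd_nat:
  fixes m :: nat
  assumes "finite A" "\<And>p. p \<in> A \<Longrightarrow> prime p" "\<And>p. p \<in> A \<Longrightarrow> p dvd m"
  shows "\<Prod>A dvd m"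
  using assms
proof (induction A rule: finite_induct)
  case (insert p A)
  have "coprime p (\<Prod>A)"
    using insert by (intro prod_coprime_right primes_coprime) auto
  then show ?case using insert by (simp add: divides_mult)
qed simp

lemma binomial_odd_le: "(2 * m + 1) choose m \<le> (4::nat) ^ m"
proof -
  have "(2 * m + 1) choose (m + 1) = (2 * m + 1) choose m"
    using binomial_symmetric[of m "2 * m + 1"] by simp
  then have "2 * ((2 * m + 1) choose m) = (\<Sum>k\<in>{m, m + 1}. (2 * m + 1) choose k)" by simp
  also have "\<dots> \<le> (\<Sum>k\<le>2 * m + 1. (2 * m + 1) choose k)" by (intro sum_mono2) auto
  also have "\<dots> = 2 * 4 ^ m" unfolding choose_row_sum by (simp add: power_mult)
  finally show ?thesis by simp
qed

text \<open>Erdos' induction: the primes in (m + 1, 2m + 1] all divide the binomial coefficient of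
  2m + 1 over m, which is at most 4^m, and the primes up to m + 1 fall under the induction
  hypothesis. An even n > 2 adds no prime.\<close>

lemma primorial_le: "\<Prod>{p. prime p \<and> p \<le> n} \<le> (4::nat) ^ n"
proof (induction n rule: less_induct)
  case (less n)
  consider "n \<le> 1" | "n = 2" | "n > 2" "even n" | m where "n = 2 * m + 1" "m \<ge> 1"
  proof -
    have "n \<le> 1 \<or> n = 2 \<or> n > 2" by linarith
    then show thesis using that by (cases "even n") (auto elim!: oddE)
  qed
  then show ?case
  proof cases
    case 1
    then have "{p. prime p \<and> p \<le> n} = {}" by (auto dest: prime_ge_2_nat)
    then show ?thesis by (simp only: prod.empty) simp
  next
    case 2
    then have "{p. prime p \<and> p \<le> n} = {2}" by (auto dest: prime_ge_2_nat)
    then show ?thesis using 2 by simp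
  next
    case 3
    have np: "\<not> prime n" using 3 by (auto simp: prime_odd_nat)
    then obtain k where k: "n = Suc k" using 3 by (cases n) auto
    then have "\<Prod>{p. prime p \<and> p \<le> n} \<le> 4 ^ k" using less[of k] np by (simp add: primes_le_Suc)
    also have "\<dots> \<le> 4 ^ n" using k by simp
    finally show ?thesis .
  next
    case (4 m)
    let ?B = "{p. prime p \<and> m + 1 < p \<and> p \<le> 2 * m + 1}"
    have dvd: "p dvd (2 * m + 1) choose m" if "p \<in> ?B" for p
    proof -
      have p: "prime p" "m + 1 < p" "p \<le> 2 * m + 1" using that by auto
      have "fact m * fact (m + 1) * ((2 * m + 1) choose m) = (fact (2 * m + 1) :: nat)"
        using binomial_fact_lemma[of m "2 * m + 1"] by (simp add: algebra_simps)
      then have "p dvd fact m * fact (m + 1) * ((2 * m + 1) choose m)"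
        using p by (simp only: prime_dvd_fact_iff)
      moreover have "\<not> p dvd fact m" "\<not> p dvd fact (m + 1)"
        using p by (simp_all add: prime_dvd_fact_iff del: fact_Suc)
      ultimately show ?thesis using p(1) by (meson prime_dvd_multD)
    qed
    have fin: "finite ?B" by (rule finite_subset[of _ "{..2 * m + 1}"]) auto
    have "{p. prime p \<and> p \<le> n} = {p. prime p \<and> p \<le> m + 1} \<union> ?B" using 4 by auto
    then have "\<Prod>{p. prime p \<and> p \<le> n} = \<Prod>{p. prime p \<and> p \<le> m + 1} * \<Prod>?B"
      using fin by (simp only:) (intro prod.union_disjoint finite_primes_le, auto)
    also have "\<dots> \<le> 4 ^ (m + 1) * 4 ^ m"
    proof (intro mult_mono)
      show "\<Prod>{p. prime p \<and> p \<le> m + 1} \<le> 4 ^ (m + 1)" using less[of "m + 1"] 4 by simp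
      have "\<Prod>?B dvd (2 * m + 1) choose m" using fin dvd by (intro prod_primes_dvd_nat) auto
      then have "\<Prod>?B \<le> (2 * m + 1) choose m" by (intro dvd_imp_le) (auto simp: zero_less_binomial)
      then show "\<Prod>?B \<le> 4 ^ m" using binomial_odd_le[of m] by linarith
    qed auto
    also have "\<dots> = 4 ^ n" using 4 by (simp add: mult_2 flip: power_add)
    finally show ?thesis .
  qed
qed

lemma theta_le: "(\<Sum>p | prime p \<and> p \<le> n. ln (real p)) \<le> 2 * real n"
proof -
  let ?P = "{p. prime p \<and> p \<le> n}"
  have "(\<Sum>p\<in>?P. ln (real p)) = ln (\<Prod>p\<in>?P. real p)"
    by (rule ln_prod[symmetric]) (auto dest: prime_gt_0_nat)
  also have "(\<Prod>p\<in>?P. real p) = real (\<Prod>?P)" by simp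
  also have "ln (real (\<Prod>?P)) \<le> ln (real (4 ^ n))"
  proof (rule ln_mono)
    show "real (\<Prod>?P) \<le> real (4 ^ n)" using primorial_le[of n] by (simp only: of_nat_le_iff)
    have "\<Prod>?P > 0" by (intro prod_pos) (auto dest: prime_gt_0_nat)
    then show "0 < real (\<Prod>?P)" by (simp only: of_nat_0_less_iff)
  qed 
  also have "\<dots> = real n * (2 * ln 2)" using ln_realpow[of 2 2] by (simp add: ln_realpow)
  also have "\<dots> \<le> real n * 2" using ln_le_minus_one[of 2] by (intro mult_left_mono) auto
  finally show ?thesis by simp
qed

section \<open>Mertens' first theorem with explicit constants\<close>

lemma ln_fact_le: "ln (fact n) \<le> real n * ln (real n)"
proof (cases "n = 0")
  case False
  have "ln (fact n :: real) \<le> ln (real n ^ n)"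
    using fact_le_power[of n, where ?'a = real] False by (intro ln_mono) auto
  then show ?thesis using False by (simp add: ln_realpow)
qed simp

lemma ln_fact_ge: "real n * ln (real n) - real n \<le> ln (fact n)"
proof (induction n)
  case (Suc n)
  show ?case
  proof (cases "n = 0")
    case False
    have "ln (1 + 1 / real n) \<le> 1 / real n" by (intro ln_add_one_self_le_self) auto
    moreover have "1 + 1 / real n = real (Suc n) / real n" using False by (simp add: field_simps)
    ultimately have "real n * (ln (real (Suc n)) - ln (real n)) \<le> 1"
      using False by (simp add: ln_div field_simps)
    moreover have "ln (fact (Suc n) :: real) = ln (real (Suc n)) + ln (fact n)"
      by (simp add: ln_mult del: of_nat_Suc)
    ultimately show ?thesis using Suc by (simp add: algebra_simps)
  qed simp
qed simp

lemma card_multiples_nat: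
  assumes "d > 0" shows "card {k \<in> {1..n}. d dvd k} = n div d"
proof -
  have "{k \<in> {1..n}. d dvd k} = (*) d ` {1..n div d}" (is "?A = ?B")
  proof
    show "?A \<subseteq> ?B"
    proof
      fix k assume "k \<in> ?A"
      then obtain j where j: "k = d * j" "1 \<le> k" "k \<le> n" by auto
      then have "j \<ge> 1" by (cases j) auto
      moreover have "j \<le> n div d" using j assms by (simp add: less_eq_div_iff_mult_less_eq mult.commute)
      ultimately show "k \<in> ?B" using j by auto
    qed
    show "?B \<subseteq> ?A" using assms
      by (auto simp: less_eq_div_iff_mult_less_eq mult.commute Suc_le_eq)
  qed
  moreover have "inj_on ((*) d) {1..n div d}" using assms by (auto simp: inj_on_def)
  ultimately show ?thesis by (simp add: card_image)
qed

text \<open>Legendre's formula: expand each log k over its divisors and exchange the sums. Both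
  halves of Mertens' theorem are read off from it.\<close>

lemma ln_fact_eq_mangoldt:
  "ln (fact n) = (\<Sum>d=1..n. mangoldt d * real (n div d))"
proof -
  have "ln (fact n :: real) = ln (\<Prod>k=1..n. real k)" by (simp add: fact_prod)
  also have "\<dots> = (\<Sum>k=1..n. ln (real k))" by (rule ln_prod) auto
  also have "\<dots> = (\<Sum>k=1..n. \<Sum>d=1..n. if d dvd k then mangoldt d else 0)"
  proof (rule sum.cong[OF refl])
    fix k assume k: "k \<in> {1..n}"
    have "ln (real k) = (\<Sum>d | d dvd k. mangoldt d)"
      using mangoldt_sum[of k, where ?'a = real] k by simp
    also have "{d. d dvd k} = {d \<in> {1..n}. d dvd k}"
      using k by (auto intro: Nat.gr0I dest: dvd_imp_le simp: Suc_le_eq)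
    also have "(\<Sum>d\<in>\<dots>. mangoldt d) = (\<Sum>d=1..n. if d dvd k then mangoldt d else 0 :: real)"
      by (rule sum.inter_filter) simp
    finally show "ln (real k) = \<dots>" .
  qed
  also have "\<dots> = (\<Sum>d=1..n. \<Sum>k=1..n. if d dvd k then mangoldt d else 0)" by (rule sum.swap)
  also have "\<dots> = (\<Sum>d=1..n. mangoldt d * real (n div d))"
  proof (rule sum.cong[OF refl])
    fix d assume "d \<in> {1..n}"
    then have "real (n div d) = (\<Sum>k\<in>{k \<in> {1..n}. d dvd k}. 1)"
      using card_multiples_nat[of d n] by simp
    also have "\<dots> = (\<Sum>k=1..n. if d dvd k then 1 else 0)" by (rule sum.inter_filter) simp
    finally show "(\<Sum>k=1..n. if d dvd k then mangoldt d else 0) = mangoldt d * real (n div d)"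
      by (simp add: sum_distrib_left if_distrib cong: if_cong)
  qed
  finally show ?thesis .
qed

text \<open>Keep only the primes in Legendre's formula. Replacing the quotients
  \<open>n div p\<close> by n/p costs theta(n), at most 2n, which is the constant 2.\<close>

lemma mertens_upper:
  assumes "n \<ge> 1"
  shows "(\<Sum>p | prime p \<and> p \<le> n. ln (real p) / real p) \<le> ln (real n) + 2"
proof -
  let ?P = "{p. prime p \<and> p \<le> n}"
  have "real n * (\<Sum>p\<in>?P. ln (real p) / real p) = (\<Sum>p\<in>?P. ln (real p) * (real n / real p))"
    by (simp add: sum_distrib_left mult_ac)
  also have "\<dots> \<le> (\<Sum>p\<in>?P. ln (real p) * (real (n div p) + 1))"
  proof (intro sum_mono mult_left_mono)
    fix p assume "p \<in> ?P"
    then have p: "p > 0" "p \<ge> 1" by (auto dest: prime_gt_0_nat simp: Suc_le_eq)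
    show "real n / real p \<le> real (n div p) + 1" 
    proof -
      have "n < (n div p + 1) * p" using dividend_less_div_times[of p n] p by simp
      then have "real n < real ((n div p + 1) * p)" by (simp only: of_nat_less_iff)
      then show ?thesis using p by (simp add: field_simps)
    qed
    show "0 \<le> ln (real p)" using p by simp
  qed
  also have "\<dots> = (\<Sum>p\<in>?P. mangoldt p * real (n div p)) + (\<Sum>p\<in>?P. ln (real p))"
    by (simp add: algebra_simps sum.distrib)
  also have "(\<Sum>p\<in>?P. mangoldt p * real (n div p)) \<le> (\<Sum>d=1..n. mangoldt d * real (n div d))"
    by (intro sum_mono2) (auto simp: mangoldt_nonneg Suc_le_eq dest: prime_gt_0_nat)
  also have "\<dots> \<le> real n * ln (real n)" using ln_fact_eq_mangoldt[of n] ln_fact_le[of n] by simp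
  finally have "real n * (\<Sum>p\<in>?P. ln (real p) / real p) \<le> real n * (ln (real n) + 2)"
    using theta_le[of n] by (simp add: algebra_simps)
  then show ?thesis using assms by simp
qed

lemma sum_ln_div_square_le:
  assumes "n \<ge> 1"
  shows "(\<Sum>k=2..n. ln (real k) / (real k * (real k - 1))) \<le> 2"
proof -
  \<comment> \<open>The strengthened bound telescopes: -(ln x + 1)/x is an antiderivative of ln x /
    x^2.\<close>
  have "(\<Sum>k=2..n. ln (real k) / (real k * (real k - 1))) \<le> ln 2 + 1 - (ln (real n + 1) + 1) / real n"
    using assms
  proof (induction n rule: dec_induct)
    case (step n)
    have "ln (1 + 1 / real (Suc n)) \<le> 1 / real (Suc n)" by (intro ln_add_one_self_le_self) auto
    moreover have "1 + 1 / real (Suc n) = (real n + 2) / (real n + 1)" by (simp add: field_simps)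
    ultimately have "(real n + 1) * (ln (real n + 2) - ln (real n + 1)) \<le> 1"
      by (simp add: ln_div field_simps)
    then have "real n * (ln (real n + 2) - ln (real n + 1)) \<le> 1"
      by (smt (verit) ln_less_cancel_iff mult_right_mono of_nat_0_le_iff)
    then have "ln (real n + 1) \<le> ln (real n + 1) + 1 - real n * (ln (real n + 2) - ln (real n + 1))"
      by simp
    then have "ln (real n + 1) / ((real n + 1) * real n)
        \<le> (ln (real n + 1) + 1 - real n * (ln (real n + 2) - ln (real n + 1))) / ((real n + 1) * real n)"
      by (rule divide_right_mono) simp
    also have "\<dots> = (ln (real n + 1) + 1) / real n - (ln (real n + 2) + 1) / (real n + 1)"
      using step by (simp add: field_simps)
    finally show ?case using step by (simp add: add_ac)
  qed simp
  also have "\<dots> \<le> 2"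
  proof -
    have "(ln (real n + 1) + 1) / real n \<ge> 0"
      by (intro divide_nonneg_nonneg add_nonneg_nonneg ln_ge_zero) auto
    then show ?thesis using ln_le_minus_one[of 2] by linarith
  qed
  finally show ?thesis .
qed

lemma sum_inverse_powers_le:
  fixes q :: real
  assumes "q > 1" shows "(\<Sum>k=1..n. 1 / q ^ k) \<le> 1 / (q - 1)"
proof -
  have "(\<Sum>k=1..n. 1 / q ^ k) = (1 - 1 / q ^ n) / (q - 1)"
  proof (induction n)
    case (Suc n)
    have "(1 - 1 / q ^ n) / (q - 1) + 1 / q ^ Suc n = (1 - 1 / q ^ Suc n) / (q - 1)"
      using assms by (simp add: field_simps)
    then show ?case using Suc by simp
  qed simp
  also have "\<dots> \<le> 1 / (q - 1)" using assms by (intro divide_right_mono) auto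
  finally show ?thesis .
qed

text \<open>Only prime powers contribute, and the powers of one prime form a geometric series with
  sum at most 1/(p - 1).\<close>

lemma sum_mangoldt_div_le:
  "(\<Sum>d=1..n. mangoldt d / real d) \<le> (\<Sum>p | prime p \<and> p \<le> n. ln (real p) / (real p - 1))"
proof -
  let ?P = "{p. prime p \<and> p \<le> n}"
  let ?f = "\<lambda>(p, k). p ^ k :: nat"
  let ?g = "\<lambda>d. mangoldt d / real d"
  have "(\<Sum>d=1..n. mangoldt d / real d) = (\<Sum>d\<in>{d \<in> {1..n}. primepow d}. ?g d)"
    by (rule sum.mono_neutral_right) (auto simp: mangoldt_def)
  also have "\<dots> \<le> (\<Sum>d\<in>?f ` (?P \<times> {1..n}). ?g d)"
  proof (rule sum_mono2)
    show "{d \<in> {1..n}. primepow d} \<subseteq> ?f ` (?P \<times> {1..n})"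
    proof
      fix d assume d: "d \<in> {d \<in> {1..n}. primepow d}"
      then obtain p k where pk: "prime p" "k > 0" "d = p ^ k" by (auto simp: primepow_def)
      have "p ^ 1 \<le> p ^ k" using pk prime_gt_0_nat[of p] by (intro power_increasing) auto
      moreover have "k < p ^ k" using pk prime_ge_2_nat[of p] by (intro power_gt_expt) auto
      ultimately have "p \<le> n" "k \<le> n" using d pk by auto
      then show "d \<in> ?f ` (?P \<times> {1..n})" using pk by (intro image_eqI[of _ _ "(p, k)"]) auto
    qed
  qed (auto simp: mangoldt_nonneg)
  also have "\<dots> \<le> (\<Sum>x\<in>?P \<times> {1..n}. (?g \<circ> ?f) x)"
    by (rule sum_image_le) (auto simp: mangoldt_nonneg)
  also have "\<dots> = (\<Sum>p\<in>?P. \<Sum>k=1..n. ?g (p ^ k))"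
    unfolding sum.cartesian_product by (rule sum.cong) auto
  also have "\<dots> \<le> (\<Sum>p\<in>?P. ln (real p) / (real p - 1))"
  proof (rule sum_mono)
    fix p assume p: "p \<in> ?P"
    then have p1: "p > 1" using prime_gt_1_nat by auto
    have "(\<Sum>k=1..n. ?g (p ^ k)) = ln (real p) * (\<Sum>k=1..n. 1 / real p ^ k)"
      unfolding sum_distrib_left using p by (intro sum.cong) auto
    also have "\<dots> \<le> ln (real p) * (1 / (real p - 1))"
      using p1 by (intro mult_left_mono sum_inverse_powers_le) auto
    finally show "(\<Sum>k=1..n. ?g (p ^ k)) \<le> ln (real p) / (real p - 1)" by simp
  qed
  finally show ?thesis .
qed

lemma sum_prime_ln_div_square_le:
  "(\<Sum>p | prime p \<and> p \<le> n. ln (real p) / (real p * (real p - 1))) \<le> 2"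
proof (cases "n \<ge> 1")
  case True
  have "(\<Sum>p | prime p \<and> p \<le> n. ln (real p) / (real p * (real p - 1)))
      \<le> (\<Sum>k=2..n. ln (real k) / (real k * (real k - 1)))"
    by (intro sum_mono2) (auto dest: prime_ge_2_nat)
  with sum_ln_div_square_le[OF True] show ?thesis by simp
next
  case False
  then have "{p. prime p \<and> p \<le> n} = {}" by (auto dest: prime_ge_2_nat)
  then show ?thesis by (simp only: sum.empty)
qed

text \<open>The 3 consists of 1 from the lower bound for the logarithm of n! and 2 from the higher
  prime powers, that is from the sum of ln p (1/(p - 1) - 1/p).\<close>

lemma mertens_lower:
  assumes "n \<ge> 1"
  shows "ln (real n) - 3 \<le> (\<Sum>p | prime p \<and> p \<le> n. ln (real p) / real p)"
proof -
  let ?P = "{p. prime p \<and> p \<le> n}"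
  have "real n * (ln (real n) - 1) \<le> (\<Sum>d=1..n. mangoldt d * real (n div d))"
    using ln_fact_ge[of n] ln_fact_eq_mangoldt[of n] by (simp add: algebra_simps)
  also have "\<dots> \<le> (\<Sum>d=1..n. mangoldt d * (real n / real d))"
    by (intro sum_mono mult_left_mono mangoldt_nonneg) (simp add: of_nat_div_le_of_nat)
  also have "\<dots> = real n * (\<Sum>d=1..n. mangoldt d / real d)"
    by (simp add: sum_distrib_left mult_ac)
  finally have "ln (real n) - 1 \<le> (\<Sum>d=1..n. mangoldt d / real d)" using assms by simp
  also have "\<dots> \<le> (\<Sum>p\<in>?P. ln (real p) / (real p - 1))" by (rule sum_mangoldt_div_le)
  also have "\<dots> = (\<Sum>p\<in>?P. ln (real p) / real p + ln (real p) / (real p * (real p - 1)))"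
  proof (rule sum.cong[OF refl])
    fix p assume "p \<in> ?P"
    then have "real p > 1" using prime_gt_1_nat by auto
    then show "ln (real p) / (real p - 1) = ln (real p) / real p + ln (real p) / (real p * (real p - 1))"
      by (simp add: field_simps)
  qed
  also have "\<dots> \<le> (\<Sum>p\<in>?P. ln (real p) / real p) + 2"
    using sum_prime_ln_div_square_le[of n] by (simp add: sum.distrib)
  finally show ?thesis by simp
qed

section \<open>Partial summation with the damping factor\<close>

lemma abel_bound:
  fixes a f :: "nat \<Rightarrow> real"
  assumes A: "\<And>k. k \<ge> 1 \<Longrightarrow> \<bar>\<Sum>j=1..k. a j\<bar> \<le> C"
    and f: "\<And>k. k \<ge> 1 \<Longrightarrow> f (Suc k) \<le> f k" "\<And>k. f k \<ge> 0" and n: "n \<ge> 1"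
  shows "\<bar>\<Sum>k=1..n. a k * f k\<bar> \<le> C * f 1"
proof -
  \<comment> \<open>With the boundary term kept apart, step n adds only the partial sum times
    \<open>f n - f (Suc n)\<close>, and these differences telescope.\<close>
  have "\<bar>(\<Sum>k=1..n. a k * f k) - (\<Sum>j=1..n. a j) * f n\<bar> \<le> C * (f 1 - f n)"
    using n
  proof (induction n rule: dec_induct)
    case (step n)
    have "\<bar>(\<Sum>j=1..n. a j) * (f n - f (Suc n))\<bar> \<le> C * (f n - f (Suc n))"
      using A[of n] f step by (auto simp: abs_mult intro!: mult_right_mono)
    moreover have "(\<Sum>k=1..Suc n. a k * f k) - (\<Sum>j=1..Suc n. a j) * f (Suc n)
       = ((\<Sum>k=1..n. a k * f k) - (\<Sum>j=1..n. a j) * f n) + (\<Sum>j=1..n. a j) * (f n - f (Suc n))"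
      by (simp add: algebra_simps)
    ultimately show ?case using step by (simp only:) (simp add: algebra_simps)
  qed simp
  moreover have "\<bar>(\<Sum>j=1..n. a j) * f n\<bar> \<le> C * f n"
    using A[of n] f n by (auto simp: abs_mult intro!: mult_right_mono)
  ultimately show ?thesis by (simp add: algebra_simps)
qed

text \<open>A Riemann sum in the variable log t for the integral of t^(-1-e) over [1, n]. Its steps
  have length at most ln 2, so the error is at most ln 2 times the total decrease of the integrand
  factor t^(-e). The term k = 1 vanishes because \<open>ln 0 = 0\<close>.\<close>

lemma sum_ln_diff_powr:
  fixes e :: real
  assumes "e > 0" "n \<ge> 1"
  shows "\<bar>(\<Sum>k=1..n. (ln (real k) - ln (real (k - 1))) * real k powr -e) - (1 - real n powr -e) / e\<bar> \<le> 1"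
proof -
  define F where "F n = (\<Sum>k=1..n. (ln (real k) - ln (real (k - 1))) * real k powr -e)" for n
  have "(1 - real n powr -e) / e - ln 2 * (1 - real n powr -e) \<le> F n \<and> F n \<le> (1 - real n powr -e) / e"
    using assms(2)
  proof (induction n rule: dec_induct)
    case (step n)
    define D where "D = ln (real (Suc n)) - ln (real n)"
    define x where "x = real n powr -e"
    define y where "y = real (Suc n) powr -e"
    have D0: "D \<ge> 0" using step by (simp add: D_def)
    have "D = ln (real (Suc n) / real n)" using step by (simp add: D_def ln_div)
    also have "\<dots> \<le> ln 2" using step by (intro ln_mono) (auto simp: field_simps)
    finally have D2: "D \<le> ln 2" .
    have xy: "x = y * exp (e * D)" "y = x * exp (- e * D)"
      using step by (simp_all add: x_def y_def D_def powr_def algebra_simps flip: exp_add)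
    have pos: "x > 0" "y > 0" using step by (simp_all add: x_def y_def)
    have "y * (1 + e * D) \<le> x" using exp_ge_add_one_self[of "e * D"] pos by (subst xy(1)) simp
    then have up: "D * y \<le> (x - y) / e" using assms by (simp add: field_simps)
    have "x * (1 - e * D) \<le> y" using exp_ge_add_one_self[of "- e * D"] pos by (subst xy(2)) simp
    then have "(x - y) / e \<le> D * x" using assms by (simp add: field_simps)
    moreover have "D * (x - y) \<le> ln 2 * (x - y)"
      using D2 xy(1) pos D0 assms by (intro mult_right_mono) auto
    ultimately have lo: "(x - y) / e - ln 2 * (x - y) \<le> D * y" by (simp add: algebra_simps)
    have "F (Suc n) = F n + D * y" using step by (simp add: F_def D_def y_def)
    then show ?case using step.IH up lo unfolding x_def[symmetric] y_def[symmetric]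
      by (simp add: diff_divide_distrib algebra_simps)
  qed (simp add: F_def)
  moreover have "ln 2 * (1 - real n powr -e) \<le> 1"
  proof -
    have "0 \<le> ln 2 * real n powr -e" by simp
    then show ?thesis using ln_le_minus_one[of 2] unfolding right_diff_distrib by linarith
  qed
  ultimately show ?thesis unfolding F_def by simp
qed

text \<open>The coefficients ln p / p minus the increments of log have partial sums bounded by 3, by
  Mertens. Summation by parts keeps that bound after damping, and passing to the integral costs 1
  more.\<close>

lemma mertens_powr:
  fixes e :: real
  assumes "e > 0" "n \<ge> 1"
  shows "\<bar>(\<Sum>p | prime p \<and> p \<le> n. ln (real p) * real p powr -(1 + e)) - (1 - real n powr -e) / e\<bar> \<le> 4"
proof -
  define b where "b k = (if prime k then ln (real k) / real k else 0)" for k :: nat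
  define a where "a k = b k - (ln (real k) - ln (real (k - 1)))" for k :: nat
  define f where "f k = real k powr -e" for k :: nat
  have sb: "(\<Sum>j=1..k. b j * h j) = (\<Sum>p | prime p \<and> p \<le> k. ln (real p) / real p * h p)"
    for h :: "nat \<Rightarrow> real" and k
  proof -
    have "(\<Sum>j=1..k. b j * h j) = (\<Sum>j=1..k. if prime j then ln (real j) / real j * h j else 0)"
      by (rule sum.cong) (auto simp: b_def)
    also have "\<dots> = (\<Sum>p\<in>{j \<in> {1..k}. prime j}. ln (real p) / real p * h p)"
      by (rule sum.inter_filter[symmetric]) simp
    also have "{j \<in> {1..k}. prime j} = {p. prime p \<and> p \<le> k}"
      by (auto simp: Suc_le_eq dest: prime_gt_0_nat)
    finally show ?thesis .
  qed
  have tel: "(\<Sum>j=1..k. ln (real j) - ln (real (j - 1))) = ln (real k)" for k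
    by (induction k) auto
  have A: "\<bar>\<Sum>j=1..k. a j\<bar> \<le> 3" if "k \<ge> 1" for k
    using mertens_upper[OF that] mertens_lower[OF that] sb[of "\<lambda>_. 1" k] tel[of k]
    by (simp add: a_def sum_subtractf)
  have dec: "f (Suc k) \<le> f k" if "k \<ge> 1" for k
    unfolding f_def using that assms by (intro powr_mono2') auto
  have "\<bar>\<Sum>k=1..n. a k * f k\<bar> \<le> 3 * f 1"
    using A dec assms by (intro abel_bound) (auto simp: f_def)
  then have "\<bar>\<Sum>k=1..n. a k * f k\<bar> \<le> 3" by (simp add: f_def)
  moreover have "(\<Sum>k=1..n. a k * f k) = (\<Sum>p | prime p \<and> p \<le> n. ln (real p) * real p powr -(1 + e))
      - (\<Sum>k=1..n. (ln (real k) - ln (real (k - 1))) * real k powr -e)"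
  proof -
    have "(\<Sum>k=1..n. a k * f k) = (\<Sum>k=1..n. b k * f k) - (\<Sum>k=1..n. (ln (real k) - ln (real (k - 1))) * f k)"
    proof -
      have "a k * f k = b k * f k - (ln (real k) - ln (real (k - 1))) * f k" for k
        by (simp add: a_def left_diff_distrib)
      then show ?thesis by (simp only: sum_subtractf)
    qed
    also have "(\<Sum>k=1..n. b k * f k) = (\<Sum>p | prime p \<and> p \<le> n. ln (real p) * real p powr -(1 + e))"
      unfolding sb
    proof (rule sum.cong[OF refl])
      fix p assume "p \<in> {p. prime p \<and> p \<le> n}"
      then have "p > 0" by (auto dest: prime_gt_0_nat)
      moreover have "-(1 + e) = -e - 1" by simp
      ultimately have "real p powr -(1 + e) = real p powr -e / real p"
        by (simp only: powr_diff) simp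
      then show "ln (real p) / real p * f p = ln (real p) * real p powr -(1 + e)"
        by (simp add: f_def)
    qed
    finally show ?thesis by (simp add: f_def)
  qed
  ultimately show ?thesis using sum_ln_diff_powr[OF assms] by linarith
qed

section \<open>A lower bound for the Euler product\<close>

lemma sum_inverse_squares_le: "n \<ge> 1 \<Longrightarrow> (\<Sum>a=1..n. 1 / real a ^ 2) \<le> 2"
proof -
  assume "n \<ge> 1"
  then have "(\<Sum>a=1..n. 1 / real a ^ 2) \<le> 2 - 1 / real n"
  proof (induction n rule: dec_induct)
    case (step n)
    have "1 / real (Suc n) ^ 2 \<le> 1 / (real n * real (Suc n))"
      using step by (intro divide_left_mono) (auto simp: power2_eq_square)
    also have "\<dots> = 1 / real n - 1 / real (Suc n)" using step by (simp add: field_simps)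
    finally show ?case using step.IH by (simp del: of_nat_Suc)
  qed simp
  moreover have "1 / real n \<ge> 0" by simp
  ultimately show ?thesis by linarith
qed

lemma ln_Suc_le_harmonic_sum: "ln (real (Suc n)) \<le> (\<Sum>k=1..n. 1 / real k)"
proof (induction n)
  case (Suc n)
  have "ln (1 + 1 / real (Suc n)) \<le> 1 / real (Suc n)" by (intro ln_add_one_self_le_self) auto
  moreover have "1 + 1 / real (Suc n) = real (Suc (Suc n)) / real (Suc n)" by (simp add: field_simps)
  ultimately have "ln (real (Suc (Suc n))) - ln (real (Suc n)) \<le> 1 / real (Suc n)"
    by (simp add: ln_div del: of_nat_Suc)
  then show ?case using Suc by (simp del: of_nat_Suc)
qed simp

lemma squarefree_eq_prod_prime_factors:
  fixes b :: nat
  assumes "squarefree b"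
  shows "\<Prod>(prime_factors b) = b"
proof -
  have b: "b \<noteq> 0" using assms by (intro notI) simp
  have "multiplicity p b = 1" if "p \<in> prime_factors b" for p
    using assms b that squarefree_factorial_semiring'[of b] by auto
  then have "(\<Prod>p\<in>prime_factors b. p ^ multiplicity p b) = \<Prod>(prime_factors b)"
    by (intro prod.cong) auto
  then show ?thesis using prime_factorization_nat[of b] b by simp
qed

text \<open>Writing k = a^2 b with b squarefree bounds the harmonic sum by the sum of 1/a^2, at most
  2, times the sum of 1/b, and the latter is dominated by the expanded product.\<close>

lemma euler_product_ge:
  assumes "n \<ge> 1"
  shows "ln (real n) \<le> 2 * (\<Prod>p | prime p \<and> p \<le> n. 1 + 1 / real p)"
proof -
  let ?P = "{p. prime p \<and> p \<le> n}"
  let ?B = "{b \<in> {1..n}. squarefree b}"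
  let ?f = "\<lambda>(a, b). a ^ 2 * b :: nat"
  have "ln (real n) \<le> ln (real (Suc n))" using assms by simp
  also have "\<dots> \<le> (\<Sum>k=1..n. 1 / real k)" by (rule ln_Suc_le_harmonic_sum)
  also have "\<dots> \<le> (\<Sum>k\<in>?f ` ({1..n} \<times> ?B). 1 / real k)"
  proof (rule sum_mono2)
    show "{1..n} \<subseteq> ?f ` ({1..n} \<times> ?B)"
    proof
      fix k assume k: "k \<in> {1..n}"
      let ?a = "square_part k" and ?b = "squarefree_part k"
      have eq: "k = ?b * ?a ^ 2" by (rule squarefree_decompose)
      have "?a \<noteq> 0" using k by simp
      then have a: "?a \<ge> 1" by linarith
      have "?b \<noteq> 0" by simp
      then have b: "?b \<ge> 1" by linarith
      have "?a * 1 \<le> ?a ^ 2 * ?b" using a b unfolding power2_eq_square mult.assoc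
        by (intro mult_left_mono) auto
      moreover have "1 * ?b \<le> ?a ^ 2 * ?b" using a by (intro mult_right_mono) auto
      ultimately have "?a \<le> k" "?b \<le> k" using eq by (simp_all add: mult.commute)
      then show "k \<in> ?f ` ({1..n} \<times> ?B)"
        using k a b eq by (intro image_eqI[of _ _ "(?a, ?b)"]) (auto simp: mult.commute)
    qed
  qed auto
  also have "\<dots> \<le> (\<Sum>x\<in>{1..n} \<times> ?B. ((\<lambda>k. 1 / real k) \<circ> ?f) x)"
    by (rule sum_image_le) auto
  also have "\<dots> = (\<Sum>a=1..n. \<Sum>b\<in>?B. 1 / real a ^ 2 * (1 / real b))"
    unfolding sum.cartesian_product by (rule sum.cong) auto
  also have "\<dots> = (\<Sum>a=1..n. 1 / real a ^ 2) * (\<Sum>b\<in>?B. 1 / real b)"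
    by (rule sum_product[symmetric])
  also have "\<dots> \<le> 2 * (\<Sum>b\<in>?B. 1 / real b)"
    using sum_inverse_squares_le[OF assms] by (intro mult_right_mono sum_nonneg) auto
  also have "(\<Sum>b\<in>?B. 1 / real b) \<le> (\<Sum>b\<in>Prod ` Pow ?P. 1 / real b)"
  proof (rule sum_mono2)
    show "?B \<subseteq> Prod ` Pow ?P"
    proof
      fix b assume b: "b \<in> ?B"
      then have "prime_factors b \<subseteq> ?P" by (auto simp: in_prime_factors_iff dest!: dvd_imp_le)
      then show "b \<in> Prod ` Pow ?P"
        using b by (intro image_eqI[of _ _ "prime_factors b"]) (auto simp: squarefree_eq_prod_prime_factors)
    qed
  qed auto
  also have "(\<Sum>b\<in>Prod ` Pow ?P. 1 / real b) \<le> (\<Sum>X\<in>Pow ?P. ((\<lambda>b. 1 / real b) \<circ> Prod) X)"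
    by (rule sum_image_le) (auto intro: prod_nonneg)
  also have "\<dots> = (\<Sum>X\<in>Pow ?P. (\<Prod>p\<in>X. 1 / real p) * (\<Prod>p\<in>?P - X. 1))"
    by (rule sum.cong) (auto simp: prod_dividef)
  also have "\<dots> = (\<Prod>p\<in>?P. 1 / real p + 1)" by (rule prod_add[symmetric]) simp
  finally show ?thesis by (simp add: add.commute)
qed

section \<open>Primes in multiplicatively long intervals\<close>

lemma finite_primes_real [simp]: "finite {p::nat. prime p \<and> x < real p \<and> real p \<le> y}"
proof (rule finite_subset)
  show "{p::nat. prime p \<and> x < real p \<and> real p \<le> y} \<subseteq> {..nat \<lfloor>y\<rfloor>}" by (auto simp: le_nat_floor)
qed simp

text \<open>The loss 6 is 2 from the upper bound at x and 4 from the lower bound at y: the 3 of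
  \<open>mertens_lower\<close> and ln 2 < 1 for rounding y down.\<close>

lemma mertens_interval:
  fixes x y :: real
  assumes "1 \<le> x" "x \<le> y"
  shows "ln (y / x) - 6 \<le> (\<Sum>p | prime p \<and> x < real p \<and> real p \<le> y. ln (real p) / real p)"
proof -
  let ?s = "\<lambda>A. \<Sum>p\<in>A. ln (real p) / real p"
  have f: "{p. prime p \<and> p \<le> nat \<lfloor>t\<rfloor>} = {p. prime p \<and> real p \<le> t}" if "t \<ge> 1" for t
  proof (intro Collect_cong conj_cong refl)
    fix p :: nat
    have "real (nat \<lfloor>t\<rfloor>) \<le> t" using that by (intro of_nat_floor) simp
    then show "p \<le> nat \<lfloor>t\<rfloor> \<longleftrightarrow> real p \<le> t" using le_nat_floor[of p t] by linarith
  qed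
  have lo: "ln t - 4 \<le> ?s {p. prime p \<and> real p \<le> t}" if "t \<ge> 1" for t
  proof -
    have "nat \<lfloor>t\<rfloor> \<ge> 1" using that by (simp add: Suc_le_eq)
    have "1 \<le> \<lfloor>t\<rfloor>" using that by simp
    moreover from this have "real (nat \<lfloor>t\<rfloor>) = of_int \<lfloor>t\<rfloor>" by simp
    ultimately have "t \<le> 2 * real (nat \<lfloor>t\<rfloor>)" by linarith
    then have "ln t \<le> ln (2 * real (nat \<lfloor>t\<rfloor>))" using that by (intro ln_mono) auto
    also have "\<dots> = ln 2 + ln (real (nat \<lfloor>t\<rfloor>))" using that by (intro ln_mult_pos) auto
    finally show ?thesis using mertens_lower[of "nat \<lfloor>t\<rfloor>"] \<open>nat \<lfloor>t\<rfloor> \<ge> 1\<close> f[OF that] ln_le_minus_one[of 2]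
      by simp
  qed
  have up: "?s {p. prime p \<and> real p \<le> t} \<le> ln t + 2" if "t \<ge> 1" for t
  proof -
    have "nat \<lfloor>t\<rfloor> \<ge> 1" using that by (simp add: Suc_le_eq)
    moreover have "ln (real (nat \<lfloor>t\<rfloor>)) \<le> ln t" using that by (intro ln_mono) auto
    ultimately show ?thesis using mertens_upper[of "nat \<lfloor>t\<rfloor>"] f[OF that] by simp
  qed
  have "{p. prime p \<and> real p \<le> y} = {p. prime p \<and> real p \<le> x} \<union> {p. prime p \<and> x < real p \<and> real p \<le> y}"
    using assms by auto
  moreover have "finite {p. prime p \<and> real p \<le> x}" using f[OF assms(1)] finite_primes_le by metis
  ultimately have "?s {p. prime p \<and> real p \<le> y}
      = ?s {p. prime p \<and> real p \<le> x} + ?s {p. prime p \<and> x < real p \<and> real p \<le> y}"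
    by (simp only:) (intro sum.union_disjoint finite_primes_real, auto)
  then show ?thesis using lo[of y] up[of x] assms by (simp add: ln_div)
qed

text \<open>The ratio exp 7 makes the lower bound of \<open>mertens_interval\<close> equal to 7 - 6
  = 1.\<close>

lemma primes_in_interval:
  fixes z :: real
  assumes "z \<ge> exp 7"
  shows theta_interval_ge: "z / exp 7 \<le> (\<Sum>p | prime p \<and> z / exp 7 < real p \<and> real p \<le> z. ln (real p))"
    and card_primes_interval_ge:
      "z / (exp 7 * ln z) \<le> real (card {p. prime p \<and> z / exp 7 < real p \<and> real p \<le> z})"
proof -
  let ?I = "{p. prime p \<and> z / exp 7 < real p \<and> real p \<le> z}"
  have z0: "z > 0" using assms by (rule less_le_trans[rotated]) simp
  have "z > 1" using assms by (rule less_le_trans[rotated]) simp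
  then have lnz: "ln z > 0" by simp
  have "1 \<le> z / exp 7" using assms by simp
  moreover have "z / exp 7 \<le> z" using z0 by (simp add: divide_le_eq)
  moreover have "ln (z / (z / exp 7)) = 7" using z0 by simp
  ultimately have "1 \<le> (\<Sum>p\<in>?I. ln (real p) / real p)" using mertens_interval[of "z / exp 7" z] by simp
  also have "\<dots> \<le> (\<Sum>p\<in>?I. ln (real p) / (z / exp 7))"
    using z0 by (intro sum_mono divide_left_mono) (auto dest: prime_gt_0_nat simp: Suc_le_eq)
  also have "\<dots> = (\<Sum>p\<in>?I. ln (real p)) / (z / exp 7)" by (rule sum_divide_distrib[symmetric])
  finally show *: "z / exp 7 \<le> (\<Sum>p\<in>?I. ln (real p))" using z0 by (simp add: field_simps)
  also have "\<dots> \<le> (\<Sum>p\<in>?I. ln z)" by (intro sum_mono ln_mono) (auto dest: prime_gt_0_nat)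
  finally show "z / (exp 7 * ln z) \<le> real (card ?I)" using lnz by (simp add: field_simps)
qed

section \<open>The stopped process\<close>

text \<open>The subtracted term is the integral of exp(-et) over [0, L]. By Mertens it is, up to a
  bounded error, the expected log of the primes up to exp L kept with probability about
  p^(-1-e).\<close>

definition excess :: "real \<Rightarrow> real \<Rightarrow> real" where
  "excess e L = L - (1 - exp (- e * L)) / e"

lemma exp_minus_le_quadratic:
  fixes u :: real
  assumes "u \<ge> 0" shows "exp (- u) \<le> 1 - u + u ^ 2 / 2"
proof -
  have q: "1 + u + u ^ 2 / 2 \<le> exp u" using assms by (rule exp_lower_Taylor_quadratic)
  \<comment> \<open>The two quadratic polynomials in u and -u multiply to 1 + u^4/4.\<close>
  have "0 \<le> (u ^ 2) ^ 2 / 4" by simp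
  also have "\<dots> = (1 - u + u ^ 2 / 2) * (1 + u + u ^ 2 / 2) - 1"
    by (simp add: power2_eq_square algebra_simps)
  finally have "1 \<le> (1 - u + u ^ 2 / 2) * (1 + u + u ^ 2 / 2)" by simp
  also have "\<dots> \<le> (1 - u + u ^ 2 / 2) * exp u"
  proof (rule mult_left_mono[OF q])
    have "0 \<le> (1 - u) ^ 2 + 1" by simp
    then show "0 \<le> 1 - u + u ^ 2 / 2" by (simp add: power2_eq_square algebra_simps)
  qed
  finally show ?thesis by (simp add: exp_minus field_simps)
qed

lemma exp_minus_ge_quadratic:
  fixes u :: real
  assumes "0 \<le> u" "u \<le> 2" shows "1 - u + u ^ 2 / 4 \<le> exp (- u)"
proof -
  have "1 - u / 2 \<le> exp (- u / 2)" using exp_ge_add_one_self[of "- u / 2"] by simp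
  \<comment> \<open>Squaring needs 1 - u/2 to be nonnegative, hence the restriction u <= 2.\<close>
  then have "(1 - u / 2) ^ 2 \<le> exp (- u / 2) ^ 2" using assms by (intro power_mono) auto
  also have "\<dots> = exp (- u)" by (simp flip: exp_double)
  finally show ?thesis by (simp add: power2_eq_square algebra_simps)
qed

lemma excess_nonneg: "e > 0 \<Longrightarrow> 0 \<le> excess e L"
  using exp_ge_add_one_self[of "- e * L"] by (simp add: excess_def field_simps)

lemma excess_le_self: "e > 0 \<Longrightarrow> L \<ge> 0 \<Longrightarrow> excess e L \<le> L"
  by (simp add: excess_def)

lemma excess_ge_linear:
  assumes "e > 0" shows "L - 1 / e \<le> excess e L"
proof -
  have "(1 - exp (- e * L)) / e \<le> 1 / e" using assms by (intro divide_right_mono) auto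
  then show ?thesis by (simp add: excess_def)
qed

lemma excess_le_quadratic:
  assumes "e > 0" "L \<ge> 0" shows "excess e L \<le> e * L ^ 2 / 2"
  using exp_minus_le_quadratic[of "e * L"] assms
  by (simp add: excess_def field_simps power2_eq_square)

lemma excess_ge_quadratic:
  assumes "e > 0" "L \<ge> 0" "e * L \<le> 2" shows "e * L ^ 2 / 4 \<le> excess e L"
  using exp_minus_ge_quadratic[of "e * L"] assms
  by (simp add: excess_def field_simps power2_eq_square)

text \<open>The constants come from \<open>drift_small\<close>: the gain there is at least
  (1/2)(1/9) ln N, the 1/9 standing for exp(-2), and it has to exceed ln y0 + 8 by 1.\<close>

locale prime_seed =
  fixes y0 N :: nat
  assumes y0: "y0 \<ge> 1"
    and N_large: "18 * (ln (real y0) + 9) \<le> ln (real N)"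
    and N_dense: "densely_divisible N"
    and N_primes: "\<And>p. prime p \<Longrightarrow> p dvd N \<Longrightarrow> p \<le> y0"
begin

lemma N_pos: "N \<ge> 1"
  using N_dense by (simp add: densely_divisible_def)

lemma ln_N_ge: "ln (real N) \<ge> 162"
proof -
  have "0 \<le> ln (real y0)" using y0 by (intro ln_ge_zero) simp
  then have "162 \<le> 18 * (ln (real y0) + 9)" by simp
  then show ?thesis using N_large by (rule order_trans)
qed

text \<open>The elements do not contain the factor N. Old elements stay in the set as the outcome in
  which the new prime is skipped. Once y exceeds N n no prime is ever attached to n again: n has
  stopped.\<close>

primrec chains :: "nat \<Rightarrow> nat set" where
  "chains 0 = {1}"
| "chains (Suc y) = chains y \<union>
     (if prime (Suc y) \<and> y0 < Suc y then (\<lambda>n. n * Suc y) ` {n \<in> chains y. Suc y \<le> N * n} else {})"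

definition big_primes :: "nat \<Rightarrow> nat set" where
  "big_primes z = {p. prime p \<and> y0 < p \<and> p \<le> z}"

text \<open>The probability that none of the primes in (y0, z] is kept.\<close>

definition Q :: "real \<Rightarrow> nat \<Rightarrow> real" where
  "Q e z = (\<Prod>p\<in>big_primes z. 1 / (1 + real p powr -(1 + e)))"

text \<open>The expected log of the product of all kept primes up to z, since p^(-s)/(1 + p^(-s)) =
  1/(1 + p^s). It is the compensator of log n.\<close>

definition S :: "real \<Rightarrow> nat \<Rightarrow> real" where
  "S e z = (\<Sum>p\<in>big_primes z. ln (real p) / (1 + real p powr (1 + e)))"

text \<open>If each prime \<open>p > y0\<close> is kept independently with probability
  \<open>p\<^sup>-\<^sup>s / (1 + p\<^sup>-\<^sup>s)\<close>, \<open>s = 1 + e\<close>, and the primes are revealed in increasing order until the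
  first one exceeding \<open>N\<close> times the product of those kept so far, or exceeding \<open>y\<close>, then
  \<open>wt e y n\<close> is the probability that \<open>n\<close> is the product of the primes kept.\<close>

definition wt :: "real \<Rightarrow> nat \<Rightarrow> nat \<Rightarrow> real" where
  "wt e y n = real n powr -(1 + e) * Q e (min (N * n) y)"

lemma finite_chains [simp]: "finite (chains y)"
  by (induction y) auto

lemma chains_pos: "n \<in> chains y \<Longrightarrow> n \<ge> 1"
  by (induction y arbitrary: n) (auto split: if_splits simp: Suc_le_eq)

lemma chains_prime_le: "n \<in> chains y \<Longrightarrow> prime p \<Longrightarrow> p dvd n \<Longrightarrow> p \<le> y"
proof (induction y arbitrary: n)
  case (Suc y)
  show ?case
  proof (cases "n \<in> chains y")
    case False
    with Suc.prems obtain m where m: "m \<in> chains y" "n = m * Suc y" by (auto split: if_splits)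
    then have "p dvd m \<or> p dvd Suc y" using Suc.prems by (simp only: prime_dvd_mult_iff)
    then show ?thesis using Suc.IH[OF m(1) Suc.prems(2)] by (auto dest: dvd_imp_le)
  next
    case True
    then show ?thesis using Suc.IH[OF True Suc.prems(2,3)] by simp
  qed
qed auto

lemma chains_dense: "n \<in> chains y \<Longrightarrow> densely_divisible (N * n)"
proof (induction y arbitrary: n)
  case (Suc y)
  show ?case
  proof (cases "n \<in> chains y")
    case False
    with Suc.prems obtain m where m: "m \<in> chains y" "Suc y \<le> N * m" "n = m * Suc y"
      and q: "prime (Suc y)" "y0 < Suc y" by (auto split: if_splits)
    have "\<not> Suc y dvd N" "\<not> Suc y dvd m" using N_primes[OF q(1)] chains_prime_le[OF m(1) q(1)] q by auto
    then have nd: "\<not> Suc y dvd N * m" using q by (simp add: prime_dvd_mult_iff)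
    then have "Suc y \<noteq> N * m" by auto
    then have "densely_divisible (N * m * Suc y)"
      using m(2) by (intro densely_divisible_mult_prime[OF Suc.IH[OF m(1)] q(1) nd]) linarith
    then show ?thesis using m(3) by (simp only: mult.assoc)
  qed (use Suc in auto)
qed (use N_dense in auto)

lemma finite_big_primes [simp]: "finite (big_primes z)"
  by (rule finite_subset[of _ "{..z}"]) (auto simp: big_primes_def)

lemma big_primes_gt_1: "p \<in> big_primes z \<Longrightarrow> p > 1"
  by (auto simp: big_primes_def dest: prime_gt_Suc_0_nat)

lemma big_primes_Suc:
  "big_primes (Suc y) =
     (if prime (Suc y) \<and> y0 < Suc y then insert (Suc y) (big_primes y) else big_primes y)"
  by (auto simp: big_primes_def le_Suc_eq)

lemma Suc_notin_big_primes [simp]: "Suc y \<notin> big_primes y"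
  by (simp add: big_primes_def)

lemma Q_pos: "Q e z > 0"
  unfolding Q_def by (intro prod_pos) (auto intro!: divide_pos_pos add_pos_nonneg)

lemma Q_antimono: "z \<le> z' \<Longrightarrow> Q e z' \<le> Q e z"
proof (induction z' rule: dec_induct)
  case (step z')
  have "Q e (Suc z') \<le> Q e z'"
  proof (cases "prime (Suc z') \<and> y0 < Suc z'")
    case True
    then have "Q e (Suc z') = 1 / (1 + real (Suc z') powr -(1 + e)) * Q e z'"
      by (simp add: Q_def big_primes_Suc del: of_nat_Suc)
    also have "\<dots> \<le> 1 * Q e z'"
      using Q_pos[of e z'] by (intro mult_right_mono) (auto simp: divide_le_eq add_pos_nonneg)
    finally show ?thesis by simp
  next
    case False
    then have "big_primes (Suc z') = big_primes z'" using big_primes_Suc by auto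
    then show ?thesis by (simp add: Q_def)
  qed
  with step show ?case by simp
qed simp

lemma Q_mono_exponent:
  assumes "e \<le> e'" shows "Q e z \<le> Q e' z"
  unfolding Q_def
proof (rule prod_mono)
  fix p assume "p \<in> big_primes z"
  then have p: "p > 1" by (rule big_primes_gt_1)
  have "real p powr -(1 + e') \<le> real p powr -(1 + e)" using assms p by (intro powr_mono) auto
  then show "0 \<le> 1 / (1 + real p powr -(1 + e)) \<and>
      1 / (1 + real p powr -(1 + e)) \<le> 1 / (1 + real p powr -(1 + e'))"
    by (auto intro!: divide_left_mono mult_pos_pos add_pos_nonneg add_nonneg_nonneg)
qed

lemma wt_nonneg: "wt e y n \<ge> 0"
  unfolding wt_def using Q_pos[of e "min (N * n) y"] by (intro mult_nonneg_nonneg) auto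

text \<open>Optional stopping without probability: a quantity conserved at every skip, stop and
  split keeps its initial total. The split creates no collisions, because the new products have a
  prime factor \<open>Suc y\<close> and the old elements have none above y.\<close>

lemma sum_chains_invariant:
  fixes F :: "nat \<Rightarrow> nat \<Rightarrow> real"
  assumes skip: "\<And>y n. n \<in> chains y \<Longrightarrow> \<not> (prime (Suc y) \<and> y0 < Suc y) \<Longrightarrow> F (Suc y) n = F y n"
    and stop: "\<And>y n. n \<in> chains y \<Longrightarrow> N * n < Suc y \<Longrightarrow> F (Suc y) n = F y n"
    and split: "\<And>y n. n \<in> chains y \<Longrightarrow> prime (Suc y) \<Longrightarrow> y0 < Suc y \<Longrightarrow> Suc y \<le> N * n \<Longrightarrow>
      F (Suc y) n + F (Suc y) (n * Suc y) = F y n"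
  shows "(\<Sum>n\<in>chains y. F y n) = F 0 1"
proof (induction y)
  case (Suc y)
  show ?case
  proof (cases "prime (Suc y) \<and> y0 < Suc y")
    case False
    then have "(\<Sum>n\<in>chains (Suc y). F (Suc y) n) = (\<Sum>n\<in>chains y. F y n)"
      using skip by (intro sum.cong) auto
    with Suc show ?thesis by simp
  next
    case True
    let ?q = "Suc y"
    let ?A = "{n \<in> chains y. ?q \<le> N * n}" and ?B = "{n \<in> chains y. \<not> ?q \<le> N * n}"
    have "n * ?q \<notin> chains y" for n
      using chains_prime_le[of "n * ?q" y ?q] True by (metis dvd_triv_right Suc_n_not_le_n)
    then have "chains y \<inter> (\<lambda>n. n * ?q) ` ?A = {}" by blast
    then have "(\<Sum>n\<in>chains ?q. F ?q n) = (\<Sum>n\<in>chains y. F ?q n) + (\<Sum>n\<in>(\<lambda>n. n * ?q) ` ?A. F ?q n)"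
      using True by (simp add: sum.union_disjoint del: mult_Suc_right)
    also have "(\<Sum>n\<in>(\<lambda>n. n * ?q) ` ?A. F ?q n) = (\<Sum>n\<in>?A. F ?q (n * ?q))"
      by (subst sum.reindex) (auto simp: inj_on_def simp del: mult_Suc_right)
    also have "(\<Sum>n\<in>chains y. F ?q n) = (\<Sum>n\<in>?A. F ?q n) + (\<Sum>n\<in>?B. F ?q n)"
      by (subst sum.union_disjoint[symmetric]) (auto intro: sum.cong)
    also have "(\<Sum>n\<in>?A. F ?q n) + (\<Sum>n\<in>?B. F ?q n) + (\<Sum>n\<in>?A. F ?q (n * ?q))
        = (\<Sum>n\<in>?A. F ?q n + F ?q (n * ?q)) + (\<Sum>n\<in>?B. F ?q n)"
      by (simp add: sum.distrib)
    also have "(\<Sum>n\<in>?A. F ?q n + F ?q (n * ?q)) = (\<Sum>n\<in>?A. F y n)"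
      using split True by (intro sum.cong) auto
    also have "(\<Sum>n\<in>?B. F ?q n) = (\<Sum>n\<in>?B. F y n)"
      using stop by (intro sum.cong) auto
    also have "(\<Sum>n\<in>?A. F y n) + (\<Sum>n\<in>?B. F y n) = (\<Sum>n\<in>chains y. F y n)"
      by (subst sum.union_disjoint[symmetric]) (auto intro: sum.cong)
    finally show ?thesis using Suc by simp
  qed
qed simp

text \<open>\<open>min m y\<close> with m = N n is the time up to which primes have been revealed
  for n; it brings in no new prime if \<open>Suc y\<close> is not eligible or n has stopped.\<close>

lemma big_primes_min_Suc:
  "\<not> (prime (Suc y) \<and> y0 < Suc y) \<or> m < Suc y \<Longrightarrow> big_primes (min m (Suc y)) = big_primes (min m y)"
  using big_primes_Suc[of y] by (cases "m \<le> y") (auto simp: min_absorb1 min_absorb2)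

lemma big_primes_0 [simp]: "big_primes 0 = {}"
  by (auto simp: big_primes_def)

lemma
  fixes e :: real
  assumes "prime (Suc y)" "y0 < Suc y" "Suc y \<le> N * n" "n \<ge> 1"
  defines "u \<equiv> real (Suc y) powr -(1 + e)"
  shows wt_step_skip: "wt e (Suc y) n = wt e y n / (1 + u)"
    and wt_step_take: "wt e (Suc y) (n * Suc y) = wt e y n * u / (1 + u)"
    and S_step: "S e (Suc y) = S e y + ln (real (Suc y)) * u / (1 + u)"
proof -
  have u: "u > 0" by (simp add: u_def)
  have Q: "Q e (Suc y) = Q e y / (1 + u)"
    using assms by (simp add: Q_def big_primes_Suc u_def del: of_nat_Suc)
  have inv: "real (Suc y) powr (1 + e) = 1 / u"
    by (simp only: u_def powr_minus inverse_eq_divide[symmetric] inverse_inverse_eq)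
  show "wt e (Suc y) n = wt e y n / (1 + u)"
    using assms(3) Q by (simp add: wt_def min_absorb2 del: of_nat_Suc)
  have "1 \<le> N * n" using assms(3) by linarith
  then have "1 * Suc y \<le> N * n * Suc y" by (rule mult_right_mono) simp
  then have "Suc y \<le> N * (n * Suc y)" by (simp only: mult.assoc mult_1)
  then have "min (N * (n * Suc y)) (Suc y) = Suc y" by (simp add: min_absorb2 del: mult_Suc_right)
  then show "wt e (Suc y) (n * Suc y) = wt e y n * u / (1 + u)"
    using assms(3) Q unfolding wt_def u_def of_nat_mult
    by (simp add: powr_mult min_absorb2 del: of_nat_Suc mult_Suc_right)
  have "S e (Suc y) = S e y + ln (real (Suc y)) / (1 + 1 / u)"
    using assms(1,2) by (simp add: S_def big_primes_Suc inv del: of_nat_Suc)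
  then show "S e (Suc y) = S e y + ln (real (Suc y)) * u / (1 + u)"
    using u by (simp add: field_simps del: of_nat_Suc)
qed

lemma sum_wt: "(\<Sum>n\<in>chains y. wt e y n) = 1"
proof -
  have "(\<Sum>n\<in>chains y. wt e y n) = wt e 0 1"
  proof (rule sum_chains_invariant)
    fix y n assume a: "n \<in> chains y" "prime (Suc y)" "y0 < Suc y" "Suc y \<le> N * n"
    define u where "u = real (Suc y) powr -(1 + e)"
    have "u > 0" by (simp add: u_def)
    then have eq: "W / (1 + u) + W * u / (1 + u) = W" for W :: real
      by (simp add: distrib_left[of W 1 u, symmetric, simplified] flip: add_divide_distrib)
    show "wt e (Suc y) n + wt e (Suc y) (n * Suc y) = wt e y n"
      unfolding wt_step_skip[OF a(2-4) chains_pos[OF a(1)], of e, folded u_def]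
        wt_step_take[OF a(2-4) chains_pos[OF a(1)], of e, folded u_def] by (rule eq)
  qed (simp_all add: wt_def Q_def big_primes_min_Suc)
  then show ?thesis by (simp add: wt_def Q_def)
qed

text \<open>The variable \<open>log n - S\<close> is a martingale, and the weights describe a stopped process.\<close>

lemma sum_wt_martingale:
  "(\<Sum>n\<in>chains y. wt e y n * (ln (real n) - S e (min (N * n) y))) = 0"
proof -
  have "(\<Sum>n\<in>chains y. wt e y n * (ln (real n) - S e (min (N * n) y)))
      = wt e 0 1 * (ln (real 1) - S e (min (N * 1) 0))"
  proof (rule sum_chains_invariant)
    fix y n assume a: "n \<in> chains y" "prime (Suc y)" "y0 < Suc y" "Suc y \<le> N * n"
    define u where "u = real (Suc y) powr -(1 + e)"
    have u: "u > 0" by (simp add: u_def)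
    note st = wt_step_skip[OF a(2-4) chains_pos[OF a(1)], of e, folded u_def]
      wt_step_take[OF a(2-4) chains_pos[OF a(1)], of e, folded u_def]
      S_step[OF a(2-4) chains_pos[OF a(1)], of e, folded u_def]
    have "1 \<le> N * n" using a(4) by linarith
    then have "1 * Suc y \<le> N * n * Suc y" by (rule mult_right_mono) simp
    then have "Suc y \<le> N * (n * Suc y)" by (simp only: mult.assoc mult_1)
    then have m: "min (N * (n * Suc y)) (Suc y) = Suc y" "min (N * n) (Suc y) = Suc y" "min (N * n) y = y"
      using a(4) by (simp_all add: min_absorb2 del: mult_Suc_right)
    have l: "ln (real (n * Suc y)) = ln (real n) + ln (real (Suc y))"
      unfolding of_nat_mult using chains_pos[OF a(1)] by (intro ln_mult_pos) auto
    \<comment> \<open>Here W is the weight, a = log n and b the log of the new prime, taken with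
      probability u/(1 + u). The mean growth b u/(1 + u) of log n is exactly the increment of
      S.\<close>
    have "W / (1 + u) * (a - (s + b * u / (1 + u))) + W * u / (1 + u) * (a + b - (s + b * u / (1 + u)))
       = W * (a - s)" for W a b s :: real
    proof -
      define r t where "r = W / (1 + u)" and "t = b * u / (1 + u)"
      have W: "W = r * (1 + u)" and t: "t * (1 + u) = b * u" using u by (simp_all add: r_def t_def)
      have "W * u / (1 + u) = r * u" by (simp add: r_def)
      then have "W / (1 + u) * (a - (s + b * u / (1 + u))) + W * u / (1 + u) * (a + b - (s + b * u / (1 + u)))
        = r * (a - (s + t)) + r * u * (a + b - (s + t))" by (simp add: r_def t_def)
      also have "\<dots> = W * (a - s)" using t unfolding W by algebra
      finally show ?thesis .
    qed
    then show "wt e (Suc y) n * (ln (real n) - S e (min (N * n) (Suc y))) +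
        wt e (Suc y) (n * Suc y) * (ln (real (n * Suc y)) - S e (min (N * (n * Suc y)) (Suc y)))
        = wt e y n * (ln (real n) - S e (min (N * n) y))"
      unfolding m l st by simp
  qed (simp_all add: wt_def Q_def S_def big_primes_min_Suc)
  then show ?thesis by (simp add: S_def)
qed

section \<open>Drift and mean excess\<close>

lemma S_upper:
  assumes "e > 0" "z \<ge> 1"
  shows "S e z \<le> (1 - real z powr -e) / e + 4"
proof -
  have "S e z \<le> (\<Sum>p\<in>big_primes z. ln (real p) * real p powr -(1 + e))"
    unfolding S_def
  proof (rule sum_mono)
    fix p assume "p \<in> big_primes z"
    then have p: "real p > 1" using big_primes_gt_1 by auto
    have "ln (real p) / (1 + real p powr (1 + e)) \<le> ln (real p) / real p powr (1 + e)"
      using p by (intro divide_left_mono) (auto intro!: mult_pos_pos add_pos_nonneg)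
    then show "ln (real p) / (1 + real p powr (1 + e)) \<le> ln (real p) * real p powr -(1 + e)"
      unfolding powr_minus by (simp add: field_simps)
  qed
  also have "\<dots> \<le> (\<Sum>p | prime p \<and> p \<le> z. ln (real p) * real p powr -(1 + e))"
    by (intro sum_mono2) (auto simp: big_primes_def Suc_le_eq dest: prime_gt_0_nat)
  finally show ?thesis using mertens_powr[OF assms] by linarith
qed

text \<open>The 8 is 4 from \<open>mertens_powr\<close>, 2 from \<open>mertens_upper\<close> for the
  missing primes up to y0, and 2 for replacing p^s by 1 + p^s in the denominators.\<close>

lemma S_lower:
  assumes "e > 0" "z \<ge> 1"
  shows "(1 - real z powr -e) / e - ln (real y0) - 8 \<le> S e z"
proof -
  let ?t = "\<lambda>p. ln (real p) * real p powr -(1 + e)"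
  have t0: "?t p \<ge> 0" if "prime p" for p using that by (auto simp: Suc_le_eq dest: prime_gt_0_nat)
  have "(\<Sum>p | prime p \<and> p \<le> z. ?t p) \<le> (\<Sum>p\<in>big_primes z \<union> {p. prime p \<and> p \<le> y0}. ?t p)"
    by (intro sum_mono2) (auto simp: big_primes_def t0)
  also have "\<dots> = (\<Sum>p\<in>big_primes z. ?t p) + (\<Sum>p | prime p \<and> p \<le> y0. ?t p)"
    by (intro sum.union_disjoint) (auto simp: big_primes_def)
  also have "(\<Sum>p | prime p \<and> p \<le> y0. ?t p) \<le> (\<Sum>p | prime p \<and> p \<le> y0. ln (real p) / real p)"
  proof (rule sum_mono)
    fix p assume "p \<in> {p. prime p \<and> p \<le> y0}"
    then have p: "real p \<ge> 1" by (auto simp: Suc_le_eq dest: prime_gt_0_nat)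
    then have "real p powr -(1 + e) \<le> real p powr -1" using assms by (intro powr_mono) auto
    also have "\<dots> = 1 / real p" using p by (simp add: powr_minus_divide)
    finally show "?t p \<le> ln (real p) / real p" using p mult_left_mono[of _ "1 / real p" "ln (real p)"] by simp
  qed
  also have "\<dots> \<le> ln (real y0) + 2" using y0 by (rule mertens_upper)
  also have "(\<Sum>p\<in>big_primes z. ?t p)
      \<le> (\<Sum>p\<in>big_primes z. ln (real p) / (1 + real p powr (1 + e)) + ln (real p) / (real p * (real p - 1)))"
  proof (rule sum_mono)
    fix p assume "p \<in> big_primes z"
    then have p: "real p > 1" using big_primes_gt_1 by auto
    define P where "P = real p powr (1 + e)"
    have "real p powr 1 \<le> P" unfolding P_def using p assms by (intro powr_mono) auto
    then have P: "P \<ge> real p" using p by simp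
    have "P > 1" using P p by simp
    then have "1 / P = (1 + P) / (P * (1 + P))" "P / (P * (1 + P)) = 1 / (1 + P)" by auto
    then have "1 / P = 1 / (1 + P) + 1 / (P * (1 + P))" unfolding add_divide_distrib by simp
    also have "1 / (P * (1 + P)) \<le> 1 / (real p * (real p - 1))"
      using P p by (intro divide_left_mono mult_mono mult_pos_pos) auto
    finally have "ln (real p) * (1 / P) \<le> ln (real p) * (1 / (1 + P) + 1 / (real p * (real p - 1)))"
      using p by (intro mult_left_mono) auto
    moreover have "real p powr -(1 + e) = 1 / P" by (simp only: P_def powr_minus_divide)
    ultimately show "?t p \<le> ln (real p) / (1 + real p powr (1 + e)) + ln (real p) / (real p * (real p - 1))"
      unfolding P_def[symmetric] by (simp add: distrib_left)
  qed
  also have "\<dots> = S e z + (\<Sum>p\<in>big_primes z. ln (real p) / (real p * (real p - 1)))"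
    by (simp add: sum.distrib S_def)
  also have "(\<Sum>p\<in>big_primes z. ln (real p) / (real p * (real p - 1)))
      \<le> (\<Sum>p | prime p \<and> p \<le> z. ln (real p) / (real p * (real p - 1)))"
    by (intro sum_mono2) (auto simp: big_primes_def Suc_le_eq dest: prime_gt_0_nat)
  also have "\<dots> \<le> 2" by (rule sum_prime_ln_div_square_le)
  finally show ?thesis using mertens_powr[OF assms] by linarith
qed

lemma exp_minus_ln_eq: "n \<ge> 1 \<Longrightarrow> exp (- e * ln (real n)) = real n powr -e"
  by (simp add: powr_def)

text \<open>The martingale identity allows log n inside the excess to be replaced by its compensator
  at the stopping time. What is left is the drift, controlled for each n separately by the estimates
  of S.\<close>

lemma sum_wt_excess_eq:
  "(\<Sum>n\<in>chains y. wt e y n * excess e (ln (real n)))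
    = (\<Sum>n\<in>chains y. wt e y n * (S e (min (N * n) y) - (1 - real n powr -e) / e))"
proof -
  have "(\<Sum>n\<in>chains y. wt e y n * excess e (ln (real n)))
      = (\<Sum>n\<in>chains y. wt e y n * (ln (real n) - S e (min (N * n) y))
          + wt e y n * (S e (min (N * n) y) - (1 - real n powr -e) / e))"
  proof (rule sum.cong[OF refl])
    fix n assume "n \<in> chains y"
    then have "excess e (ln (real n)) = ln (real n) - (1 - real n powr -e) / e"
      by (simp add: excess_def exp_minus_ln_eq[OF chains_pos] del: mult_minus_left)
    then show "wt e y n * excess e (ln (real n)) = wt e y n * (ln (real n) - S e (min (N * n) y))
          + wt e y n * (S e (min (N * n) y) - (1 - real n powr -e) / e)"
      by (simp only: distrib_left[symmetric]) simp
  qed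
  then show ?thesis by (simp add: sum.distrib sum_wt_martingale)
qed

lemma powr_Nn:
  assumes "n \<ge> 1" shows "real (N * n) powr -e = real n powr -e * real N powr -e"
  using N_pos assms by (simp add: powr_mult)

text \<open>Stopping at N n rather than n adds n^(-e) (1 - N^(-e))/e to the main term, at most ln N.
  The bound is independent of e and y, which is what makes comparisons between exponents
  possible.\<close>

lemma sum_wt_excess_le:
  assumes "e > 0" "y \<ge> 1"
  shows "(\<Sum>n\<in>chains y. wt e y n * excess e (ln (real n))) \<le> ln (real N) + 4"
proof -
  have "(\<Sum>n\<in>chains y. wt e y n * (S e (min (N * n) y) - (1 - real n powr -e) / e))
     \<le> (\<Sum>n\<in>chains y. wt e y n * (ln (real N) + 4))"
  proof (intro sum_mono mult_left_mono wt_nonneg)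
    fix n assume "n \<in> chains y"
    then have n: "n \<ge> 1" by (rule chains_pos)
    let ?m = "min (N * n) y"
    have m: "1 \<le> ?m" using n N_pos assms by simp
    have "S e ?m \<le> (1 - real ?m powr -e) / e + 4" using assms m by (intro S_upper)
    also have "real ?m \<le> real (N * n)" by (simp only: of_nat_le_iff min.cobounded1)
    then have "real (N * n) powr -e \<le> real ?m powr -e"
      using m assms by (intro powr_mono2') auto
    then have "(1 - real ?m powr -e) / e \<le> (1 - real (N * n) powr -e) / e"
      using assms by (intro divide_right_mono) auto
    also have "\<dots> = (1 - real n powr -e) / e + real n powr -e * ((1 - real N powr -e) / e)"
      unfolding powr_Nn[OF n] using assms by (simp add: field_simps)
    also have "real n powr -e * ((1 - real N powr -e) / e) \<le> 1 * ln (real N)"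
    proof (rule mult_mono)
      have "real n powr -e \<le> 1 powr -e" using n assms by (intro powr_mono2') auto
      then show "real n powr -e \<le> 1" by simp
      have "1 - e * ln (real N) \<le> real N powr -e"
        using exp_ge_add_one_self[of "- e * ln (real N)"] unfolding exp_minus_ln_eq[OF N_pos] by simp
      then show "(1 - real N powr -e) / e \<le> ln (real N)" using assms by (simp add: field_simps)
      have "real N powr -e \<le> 1 powr -e" using N_pos assms by (intro powr_mono2') auto
      then show "0 \<le> (1 - real N powr -e) / e" using assms by simp
    qed (use ln_N_ge in auto)
    finally show "S e ?m - (1 - real n powr -e) / e \<le> ln (real N) + 4" by simp
  qed
  also have "\<dots> = ln (real N) + 4" by (simp add: sum_wt flip: sum_distrib_right)
  finally show ?thesis by (simp add: sum_wt_excess_eq)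
qed

lemma sum_chains_filter_le:
  assumes "\<And>n. n \<in> chains y \<Longrightarrow> f n \<ge> (0::real)"
  shows "(\<Sum>n\<in>{n \<in> chains y. P n}. f n) \<le> (\<Sum>n\<in>chains y. f n)"
  using assms by (intro sum_mono2) auto

text \<open>Since y is beyond N n, the process has stopped at N n. The overshoot is at least exp(-2)
  times (ln N)/2, and \<open>N_large\<close> makes this exceed the error in
  \<open>S_lower\<close>.\<close>

lemma drift_small:
  assumes "e > 0" "e * ln (real N) \<le> 1" "n \<in> chains y" "ln (real n) \<le> 2 / e"
    and "real N * exp (2 / e) \<le> real y"
  shows "1 \<le> S e (min (N * n) y) - (1 - real n powr -e) / e"
proof -
  have n: "n \<ge> 1" using assms(3) by (rule chains_pos)
  have "real n = exp (ln (real n))" using n by simp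
  also have "\<dots> \<le> exp (2 / e)" using assms(4) by simp
  finally have "real N * real n \<le> real N * exp (2 / e)" by (intro mult_left_mono) auto
  with assms(5) have "real (N * n) \<le> real y" by simp
  then have "N * n \<le> y" by (simp only: of_nat_le_iff)
  then have m: "min (N * n) y = N * n" by simp
  define v where "v = e * ln (real N)"
  have v: "0 \<le> v" "v \<le> 1" using assms ln_N_ge by (auto simp: v_def)
  have "v * v \<le> v * 1" using v by (intro mult_left_mono) auto
  then have "v / 2 \<le> 1 - exp (- v)"
    using exp_minus_le_quadratic[OF v(1)] by (simp add: power2_eq_square)
  moreover have "exp (- v) = real N powr -e" using N_pos by (simp add: v_def powr_def)
  ultimately have "v / 2 / e \<le> (1 - real N powr -e) / e"
    using assms(1) by (intro divide_right_mono) auto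
  then have a: "ln (real N) / 2 \<le> (1 - real N powr -e) / e" using assms(1) by (simp add: v_def)
  have "exp (2::real) = exp 1 ^ 2" by (simp flip: exp_double)
  also have "\<dots> \<le> 3 ^ 2" using exp_le by (intro power_mono) auto
  finally have "1 / 9 \<le> exp (- 2 :: real)" by (simp add: exp_minus field_simps)
  also have "- 2 \<le> - e * ln (real n)" using assms(1,4) by (simp add: field_simps)
  then have "exp (- 2) \<le> real n powr -e" using exp_minus_ln_eq[OF n, of e] by (metis exp_le_cancel_iff)
  finally have "1 / 9 * (ln (real N) / 2) \<le> real n powr -e * ((1 - real N powr -e) / e)"
    using a ln_N_ge by (intro mult_mono) auto
  moreover have "18 * (a + 9) \<le> l \<Longrightarrow> 1 / 9 * (l / 2) \<le> X \<Longrightarrow> a + 9 \<le> X" for a l X :: real by argo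
  ultimately have "ln (real y0) + 9 \<le> real n powr -e * ((1 - real N powr -e) / e)" using N_large by blast
  also have "\<dots> = (1 - real (N * n) powr -e) / e - (1 - real n powr -e) / e"
    unfolding powr_Nn[OF n] using assms(1) by (simp add: field_simps)
  finally show ?thesis unfolding m using S_lower[OF assms(1), of "N * n"] n N_pos by simp
qed

text \<open>A crude bound for the n not covered by \<open>drift_small\<close>. The condition on y
  limits the cost of truncating the process at y to 1; the rest is ln y0 + 8.\<close>

lemma drift_ge:
  assumes "e > 0" "n \<in> chains y" "y \<ge> 1" "real y powr -e \<le> e"
  shows "- ln (real N) \<le> S e (min (N * n) y) - (1 - real n powr -e) / e"
proof -
  have n: "n \<ge> 1" using assms(2) by (rule chains_pos)
  let ?m = "min (N * n) y"
  have m: "?m \<ge> 1" using n N_pos assms by simp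
  have "real ?m powr -e \<le> real n powr -e + real y powr -e"
  proof (cases "N * n \<le> y")
    case True
    have "1 * n \<le> N * n" using N_pos by (intro mult_right_mono) auto
    then have "real (N * n) powr -e \<le> real n powr -e" using n assms(1)
      by (intro powr_mono2') (auto simp del: of_nat_mult)
    then show ?thesis using True by (simp add: min_absorb1 add_increasing2)
  next
    case False
    then show ?thesis by (simp add: min_absorb2)
  qed
  then have "- e \<le> real n powr -e - real ?m powr -e" using assms by simp
  then have "- e / e \<le> (real n powr -e - real ?m powr -e) / e"
    using assms(1) by (intro divide_right_mono) auto
  then have "- 1 \<le> (1 - real ?m powr -e) / e - (1 - real n powr -e) / e"
    using assms(1) by (simp add: diff_divide_distrib)
  moreover have "0 \<le> ln (real y0)" using y0 by simp
  ultimately show ?thesis using S_lower[OF assms(1) m] N_large by simp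
qed

text \<open>Where L > 2/e the excess is at least 1/e, so by Markov's inequality the total weight T
  there is at most (ln N + 4) e. All other n have drift at least 1, and the hypothesis on e makes
  the total loss (1 + ln N) T at most 1/2.\<close>

lemma sum_wt_excess_ge:
  assumes e: "e > 0" "2 * (ln (real N) + 4) * (1 + ln (real N)) * e \<le> 1"
    and y: "real y powr -e \<le> e" "real N * exp (2 / e) \<le> real y"
  shows "1 / 2 \<le> (\<Sum>n\<in>chains y. wt e y n * excess e (ln (real n)))"
proof -
  define l where "l = ln (real N)"
  have l: "l \<ge> 162" using ln_N_ge by (simp add: l_def)
  have "1 * 1 \<le> real N * exp (2 / e)" using N_pos e by (intro mult_mono) auto
  with y have y1: "y \<ge> 1" by simp
  have "1 * l \<le> 2 * (l + 4) * (1 + l)" using l by (intro mult_mono) auto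
  then have "l * e \<le> 2 * (l + 4) * (1 + l) * e" using e(1) by (intro mult_right_mono) auto
  then have el: "e * ln (real N) \<le> 1" using e(2) unfolding l_def by (simp only: mult.commute)
  let ?far = "{n \<in> chains y. 2 / e < ln (real n)}" and ?near = "{n \<in> chains y. \<not> 2 / e < ln (real n)}"
  let ?d = "\<lambda>n. S e (min (N * n) y) - (1 - real n powr -e) / e"
  have split: "sum f (chains y) = sum f ?near + sum f ?far" for f :: "nat \<Rightarrow> real"
    by (subst sum.union_disjoint[symmetric]) (auto intro: sum.cong)
  define T where "T = (\<Sum>n\<in>?far. wt e y n)"
  have "T * (1 / e) = (\<Sum>n\<in>?far. wt e y n * (1 / e))" unfolding T_def by (rule sum_distrib_right)
  also have "\<dots> \<le> (\<Sum>n\<in>?far. wt e y n * excess e (ln (real n)))"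
  proof (intro sum_mono mult_left_mono wt_nonneg)
    fix n assume "n \<in> ?far"
    then have "2 / e < ln (real n)" by simp
    then show "1 / e \<le> excess e (ln (real n))"
      using excess_ge_linear[OF e(1), of "ln (real n)"] by (simp add: field_simps)
  qed
  also have "\<dots> \<le> (\<Sum>n\<in>chains y. wt e y n * excess e (ln (real n)))"
    using wt_nonneg excess_nonneg[OF e(1)] by (intro sum_chains_filter_le) auto
  also have "\<dots> \<le> l + 4" using sum_wt_excess_le[OF e(1) y1] by (simp add: l_def)
  finally have "T \<le> (l + 4) * e" using e(1) by (simp add: field_simps)
  then have "(1 + l) * T \<le> (1 + l) * ((l + 4) * e)" using l by (intro mult_left_mono) auto
  also have "\<dots> = (2 * (l + 4) * (1 + l) * e) / 2" by (simp add: algebra_simps)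
  also have "\<dots> \<le> 1 / 2" using e(2) by (simp add: l_def)
  finally have T: "(1 + l) * T \<le> 1 / 2" .
  have near: "(\<Sum>n\<in>?near. wt e y n * 1) \<le> (\<Sum>n\<in>?near. wt e y n * ?d n)"
    using e(1) el y(2) by (intro sum_mono mult_left_mono wt_nonneg drift_small) auto
  have far: "(\<Sum>n\<in>?far. wt e y n * (- l)) \<le> (\<Sum>n\<in>?far. wt e y n * ?d n)"
    unfolding l_def using e(1) y1 y(1) by (intro sum_mono mult_left_mono wt_nonneg drift_ge) auto
  have "(\<Sum>n\<in>?near. wt e y n) = 1 - T"
    using split[of "wt e y"] sum_wt[of e y] by (simp add: T_def)
  with near far have "1 - T - l * T \<le> (\<Sum>n\<in>chains y. wt e y n * ?d n)"
    unfolding split[of "\<lambda>n. wt e y n * ?d n"] sum_distrib_right[symmetric] T_def[symmetric] by (simp add: mult.commute[of l T])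
  with T show ?thesis unfolding sum_wt_excess_eq by (simp add: algebra_simps)
qed

section \<open>Tails of log n by comparing exponents\<close>

lemma wt_le_half_exponent:
  assumes "0 < e" "e \<le> 1" "y \<ge> 1" "n \<in> chains y"
  shows "wt e y n \<le> exp 6 * real n powr -(e / 2) * wt (e / 2) y n"
proof -
  have n: "n \<ge> 1" using assms(4) by (rule chains_pos)
  let ?m = "min (N * n) y"
  have m: "?m \<ge> 1" using n N_pos assms by simp
  \<comment> \<open>Per prime, the quotient of the two factors is (1 + a)/(1 + b) with a - b at most
    (e/2) a ln p. The quotients multiply to at most exp(e S) with S taken at e/2; S <= 2/e + 4 and e
    <= 1 then give exp 6.\<close>
  have "Q e ?m \<le> Q (e / 2) ?m * (\<Prod>p\<in>big_primes ?m. exp (e * (ln (real p) / (1 + real p powr (1 + e / 2)))))"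
    unfolding Q_def prod.distrib[symmetric]
  proof (rule prod_mono)
    fix p assume "p \<in> big_primes ?m"
    then have p: "real p > 1" using big_primes_gt_1 by auto
    define a where "a = real p powr -(1 + e / 2)"
    define b where "b = real p powr -(1 + e)"
    define t where "t = e * (ln (real p) / (1 + real p powr (1 + e / 2)))"
    have a: "a > 0" and b: "b > 0" using p by (auto simp: a_def b_def)
    have P1: "real p powr (1 + e / 2) \<ge> 1" using p assms by (intro ge_one_powr_ge_zero) auto
    have "-(1 + e) = -(1 + e / 2) + -(e / 2)" by simp
    then have "b = a * real p powr -(e / 2)" by (simp only: a_def b_def powr_add)
    also have "real p powr -(e / 2) = exp (- (e / 2) * ln (real p))" using p by (simp add: powr_def)
    also have "a * \<dots> \<ge> a * (1 - e / 2 * ln (real p))"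
      using a exp_ge_add_one_self[of "- (e / 2) * ln (real p)"] by (intro mult_left_mono) auto
    finally have "a - b \<le> e / 2 * ln (real p) * a" by (simp add: algebra_simps)
    also have "e / 2 * ln (real p) * a = e / 2 * ln (real p) * (1 / real p powr (1 + e / 2))"
      by (simp only: a_def powr_minus_divide)
    also have "1 / real p powr (1 + e / 2) \<le> 2 / (1 + real p powr (1 + e / 2))" using P1 p by (simp add: field_simps)
    then have "e / 2 * ln (real p) * (1 / real p powr (1 + e / 2)) \<le> e / 2 * ln (real p) * (2 / (1 + real p powr (1 + e / 2)))"
      using assms p by (intro mult_left_mono) auto
    also have "\<dots> = t" by (simp add: t_def)
    finally have ab: "a - b \<le> t" .
    have "0 \<le> t" using assms p by (simp add: t_def)
    then have "0 \<le> b * t" using b by simp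
    then have "1 + a \<le> (1 + b) * (1 + t)" using ab by (simp add: algebra_simps)
    also have "\<dots> \<le> (1 + b) * exp t" using b exp_ge_add_one_self[of t] by (intro mult_left_mono) auto
    finally have "1 / (1 + b) \<le> 1 / (1 + a) * exp t" using a b by (simp add: field_simps)
    then show "0 \<le> 1 / (1 + real p powr -(1 + e)) \<and> 1 / (1 + real p powr -(1 + e)) \<le>
        1 / (1 + real p powr -(1 + e / 2)) * exp (e * (ln (real p) / (1 + real p powr (1 + e / 2))))"
      using b unfolding a_def[symmetric] b_def[symmetric] t_def[symmetric] by simp
  qed
  also have "(\<Prod>p\<in>big_primes ?m. exp (e * (ln (real p) / (1 + real p powr (1 + e / 2))))) = exp (e * S (e / 2) ?m)"
    by (simp add: S_def exp_sum sum_distrib_left)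
  also have "Q (e / 2) ?m * \<dots> \<le> Q (e / 2) ?m * exp 6"
  proof (rule mult_left_mono)
    have "S (e / 2) ?m \<le> (1 - real ?m powr -(e / 2)) / (e / 2) + 4" using assms m by (intro S_upper) auto
    also have "(1 - real ?m powr -(e / 2)) / (e / 2) \<le> 1 / (e / 2)" using assms by (intro divide_right_mono) auto
    finally have "e * S (e / 2) ?m \<le> e * (1 / (e / 2) + 4)" using assms by (intro mult_left_mono) auto
    also have "\<dots> = 2 + 4 * e" using assms by (simp add: field_simps)
    also have "\<dots> \<le> 6" using assms by simp
    finally show "exp (e * S (e / 2) ?m) \<le> exp 6" by simp
  qed (use Q_pos[of "e / 2" ?m] in simp)
  finally have "wt e y n \<le> real n powr -(1 + e) * (Q (e / 2) ?m * exp 6)"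
    unfolding wt_def by (intro mult_left_mono) auto
  also have "-(1 + e) = -(e / 2) + -(1 + e / 2)" by simp
  then have "real n powr -(1 + e) = real n powr -(e / 2) * real n powr -(1 + e / 2)"
    by (simp only: powr_add)
  finally show ?thesis by (simp add: wt_def mult_ac)
qed

text \<open>Passing to e/2 gains n^(-e/2), at most exp(-K/2) on this range. The excess at most
  doubles: K >= 4 gives L >= 4/e, so the excess for e/2, at least L - 2/e, is at least L/2.\<close>

lemma large_tail:
  assumes "0 < e" "e \<le> 1" "4 \<le> K" "y \<ge> 1"
  shows "(\<Sum>n\<in>{n \<in> chains y. K / e < ln (real n)}. wt e y n * excess e (ln (real n)))
    \<le> 2 * exp 6 * exp (- K / 2) * (ln (real N) + 4)"
proof -
  let ?C = "2 * exp 6 * exp (- K / 2)"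
  have "(\<Sum>n\<in>{n \<in> chains y. K / e < ln (real n)}. wt e y n * excess e (ln (real n)))
    \<le> (\<Sum>n\<in>{n \<in> chains y. K / e < ln (real n)}. ?C * (wt (e / 2) y n * excess (e / 2) (ln (real n))))"
  proof (rule sum_mono)
    fix n assume n: "n \<in> {n \<in> chains y. K / e < ln (real n)}"
    then have n1: "n \<ge> 1" using chains_pos by auto
    define L where "L = ln (real n)"
    have L: "K < L * e" "0 \<le> L" using n n1 assms by (auto simp: L_def field_simps)
    have "4 / e \<le> L" using L assms by (simp add: field_simps)
    then have x: "excess e L \<le> 2 * excess (e / 2) L"
    proof -
      define r where "r = 1 / (e / 2)"
      have "4 / e = 2 * r" by (simp add: r_def)
      then have "2 * r \<le> L" using \<open>4 / e \<le> L\<close> by simp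
      moreover have "L - r \<le> excess (e / 2) L" unfolding r_def using assms by (intro excess_ge_linear) simp
      ultimately show ?thesis using excess_le_self[of e L] assms L by simp
    qed
    have "real n powr -(e / 2) = exp (- (L * e) / 2)" using n1 by (simp add: powr_def L_def)
    also have "\<dots> \<le> exp (- K / 2)" using L by simp
    finally have decay: "exp 6 * real n powr -(e / 2) * wt (e / 2) y n \<le> exp 6 * exp (- K / 2) * wt (e / 2) y n"
      by (intro mult_right_mono mult_left_mono wt_nonneg) auto
    have "wt e y n \<le> exp 6 * real n powr -(e / 2) * wt (e / 2) y n"
      using n by (intro wt_le_half_exponent[OF assms(1,2,4)]) simp
    then have "wt e y n \<le> exp 6 * exp (- K / 2) * wt (e / 2) y n" using decay by (rule order_trans)
    then have "wt e y n * excess e L \<le> exp 6 * exp (- K / 2) * wt (e / 2) y n * (2 * excess (e / 2) L)"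
      using x assms excess_nonneg[OF assms(1), of L] wt_nonneg by (intro mult_mono) auto
    then show "wt e y n * excess e (ln (real n)) \<le> ?C * (wt (e / 2) y n * excess (e / 2) (ln (real n)))"
      by (simp add: L_def mult_ac)
  qed
  also have "\<dots> = ?C * (\<Sum>n\<in>{n \<in> chains y. K / e < ln (real n)}. wt (e / 2) y n * excess (e / 2) (ln (real n)))"
    by (rule sum_distrib_left[symmetric])
  also have "\<dots> \<le> ?C * (ln (real N) + 4)"
  proof (rule mult_left_mono)
    have "(\<Sum>n\<in>{n \<in> chains y. K / e < ln (real n)}. wt (e / 2) y n * excess (e / 2) (ln (real n)))
        \<le> (\<Sum>n\<in>chains y. wt (e / 2) y n * excess (e / 2) (ln (real n)))"
      using assms by (intro sum_chains_filter_le mult_nonneg_nonneg wt_nonneg excess_nonneg) auto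
    also have "\<dots> \<le> ln (real N) + 4" using assms by (intro sum_wt_excess_le) auto
    finally show "(\<Sum>n\<in>{n \<in> chains y. K / e < ln (real n)}. wt (e / 2) y n * excess (e / 2) (ln (real n)))
        \<le> ln (real N) + 4" .
  qed simp
  finally show ?thesis .
qed

text \<open>In the quadratic range the excess is proportional to the exponent up to a factor 2, so
  passing to the larger e' gains e/e'. The weights change by a factor at most exp 1 <= 3, because L
  <= 1/e' and Q increases with the exponent; this gives 6.\<close>

lemma small_tail:
  assumes "0 < e" "e \<le> e'" "y \<ge> 1"
  shows "(\<Sum>n\<in>{n \<in> chains y. ln (real n) \<le> 1 / e'}. wt e y n * excess e (ln (real n)))
    \<le> 6 * (e / e') * (ln (real N) + 4)"
proof -
  let ?C = "6 * (e / e')"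
  let ?A = "{n \<in> chains y. ln (real n) \<le> 1 / e'}"
  have e': "e' > 0" using assms by simp
  have "(\<Sum>n\<in>?A. wt e y n * excess e (ln (real n))) \<le> (\<Sum>n\<in>?A. ?C * (wt e' y n * excess e' (ln (real n))))"
  proof (rule sum_mono)
    fix n assume n: "n \<in> ?A"
    then have n1: "n \<ge> 1" using chains_pos by auto
    define L where "L = ln (real n)"
    have L: "0 \<le> L" "e' * L \<le> 1" using n n1 e' by (auto simp: L_def field_simps)
    have "excess e L \<le> e * L ^ 2 / 2" using assms L by (intro excess_le_quadratic) auto
    also have "\<dots> = 2 * (e / e') * (e' * L ^ 2 / 4)" using e' by (simp add: field_simps)
    also have "\<dots> \<le> 2 * (e / e') * excess e' L"
      using assms L e' by (intro mult_left_mono excess_ge_quadratic) auto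
    finally have x: "excess e L \<le> 2 * (e / e') * excess e' L" .
    have "real n powr -(1 + e) = real n powr -(1 + e') * real n powr (e' - e)"
      by (simp flip: powr_add)
    also have "real n powr (e' - e) = exp ((e' - e) * L)" using n1 by (simp add: powr_def L_def)
    also have "\<dots> \<le> exp 1"
    proof -
      have "(e' - e) * L \<le> e' * L" using L assms by (intro mult_right_mono) auto
      then show ?thesis using L by simp
    qed
    also have "\<dots> \<le> 3" by (rule exp_le)
    finally have "real n powr -(1 + e) \<le> real n powr -(1 + e') * 3" by (simp add: mult_left_mono)
    then have "wt e y n \<le> (real n powr -(1 + e') * 3) * Q e' (min (N * n) y)"
      unfolding wt_def using Q_pos[of e "min (N * n) y"] Q_mono_exponent[OF assms(2)]
      by (intro mult_mono) auto
    then have "wt e y n * excess e L \<le> 3 * wt e' y n * (2 * (e / e') * excess e' L)"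
      using x assms excess_nonneg[OF assms(1), of L] wt_nonneg[of e' y n]
      by (intro mult_mono) (auto simp: wt_def)
    then show "wt e y n * excess e (ln (real n)) \<le> ?C * (wt e' y n * excess e' (ln (real n)))"
      by (simp add: L_def mult_ac)
  qed
  also have "\<dots> = ?C * (\<Sum>n\<in>?A. wt e' y n * excess e' (ln (real n)))"
    by (rule sum_distrib_left[symmetric])
  also have "\<dots> \<le> ?C * (ln (real N) + 4)"
  proof (rule mult_left_mono)
    have "(\<Sum>n\<in>?A. wt e' y n * excess e' (ln (real n))) \<le> (\<Sum>n\<in>chains y. wt e' y n * excess e' (ln (real n)))"
      using e' by (intro sum_chains_filter_le mult_nonneg_nonneg wt_nonneg excess_nonneg) auto
    also have "\<dots> \<le> ln (real N) + 4" using e' assms by (intro sum_wt_excess_le) auto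
    finally show "(\<Sum>n\<in>?A. wt e' y n * excess e' (ln (real n))) \<le> ln (real N) + 4" .
  qed (use assms e' in simp)
  finally show ?thesis .
qed

section \<open>Positive reciprocal sums at scale 1/e\<close>

lemma Q_le:
  assumes "0 < e" "z \<ge> 2" "e * ln (real z) \<le> 1" "e \<le> 1"
  shows "Q e z \<le> 2 ^ (y0 + 1) * exp 3 / ln (real z)"
proof -
  let ?small = "{p. prime p \<and> p \<le> min y0 z}"
  have "ln (real z) \<le> 2 * (\<Prod>p | prime p \<and> p \<le> z. 1 + 1 / real p)"
    using assms by (intro euler_product_ge) simp
  also have "{p. prime p \<and> p \<le> z} = ?small \<union> big_primes z" by (auto simp: big_primes_def)
  also have "(\<Prod>p\<in>\<dots>. 1 + 1 / real p) = (\<Prod>p\<in>?small. 1 + 1 / real p) * (\<Prod>p\<in>big_primes z. 1 + 1 / real p)"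
    by (intro prod.union_disjoint finite_primes_le finite_big_primes) (auto simp: big_primes_def)
  finally have total: "ln (real z) \<le> 2 * ((\<Prod>p\<in>?small. 1 + 1 / real p) * (\<Prod>p\<in>big_primes z. 1 + 1 / real p))" .
  have "(\<Prod>p\<in>?small. 1 + 1 / real p) \<le> (\<Prod>p\<in>?small. 2)"
    by (intro prod_mono) (auto dest: prime_gt_0_nat)
  also have "\<dots> = 2 ^ card ?small" by (simp only: prod_constant)
  also have "\<dots> \<le> 2 ^ y0"
  proof (rule power_increasing)
    have "card ?small \<le> card {1..y0}" by (intro card_mono) (auto simp: Suc_le_eq dest: prime_gt_0_nat)
    then show "card ?small \<le> y0" by simp
  qed simp
  finally have small: "(\<Prod>p\<in>?small. 1 + 1 / real p) \<le> 2 ^ y0" .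
  \<comment> \<open>Undoing the damping p^(-e) costs at most exp(e times the sum of ln p / p), hence
    at most exp(e (ln z + 2)) <= exp 3.\<close>
  have "(\<Prod>p\<in>big_primes z. 1 + 1 / real p) \<le> (\<Prod>p\<in>big_primes z. (1 + real p powr -(1 + e)) * exp (e * (ln (real p) / real p)))"
  proof (rule prod_mono)
    fix p assume "p \<in> big_primes z"
    then have p: "real p > 1" using big_primes_gt_1 by auto
    define b where "b = real p powr -(1 + e)"
    define t where "t = e * (ln (real p) / real p)"
    have b: "b > 0" using p by (simp add: b_def)
    have "-(1 + e) = -e - 1" by simp
    then have "b = real p powr -e / real p" using p by (simp only: b_def powr_diff) simp
    also have "real p powr -e = exp (-e * ln (real p))" using p by (simp add: powr_def)
    also have "exp (-e * ln (real p)) / real p \<ge> (1 - e * ln (real p)) / real p"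
      using p exp_ge_add_one_self[of "-e * ln (real p)"] by (intro divide_right_mono) auto
    finally have ab: "1 / real p - b \<le> t" by (simp add: t_def diff_divide_distrib)
    have "0 \<le> t" using assms p by (simp add: t_def)
    then have "0 \<le> b * t" using b by simp
    then have "1 + 1 / real p \<le> (1 + b) * (1 + t)" using ab by (simp add: algebra_simps)
    also have "\<dots> \<le> (1 + b) * exp t" using b exp_ge_add_one_self[of t] by (intro mult_left_mono) auto
    finally show "0 \<le> 1 + 1 / real p \<and> 1 + 1 / real p \<le> (1 + real p powr -(1 + e)) * exp (e * (ln (real p) / real p))"
      unfolding b_def[symmetric] t_def[symmetric] by simp
  qed
  also have "\<dots> = (\<Prod>p\<in>big_primes z. 1 + real p powr -(1 + e)) * exp (e * (\<Sum>p\<in>big_primes z. ln (real p) / real p))"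
    by (simp add: prod.distrib exp_sum sum_distrib_left)
  also have "(\<Prod>p\<in>big_primes z. 1 + real p powr -(1 + e)) = 1 / Q e z"
    by (simp add: Q_def prod_dividef)
  also have "1 / Q e z * exp (e * (\<Sum>p\<in>big_primes z. ln (real p) / real p)) \<le> 1 / Q e z * exp 3"
  proof (rule mult_left_mono)
    have "(\<Sum>p\<in>big_primes z. ln (real p) / real p) \<le> (\<Sum>p | prime p \<and> p \<le> z. ln (real p) / real p)"
      by (intro sum_mono2) (auto simp: big_primes_def Suc_le_eq dest: prime_gt_0_nat)
    also have "\<dots> \<le> ln (real z) + 2" using assms by (intro mertens_upper) simp
    finally have "e * (\<Sum>p\<in>big_primes z. ln (real p) / real p) \<le> e * (ln (real z) + 2)"
      using assms by (intro mult_left_mono) auto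
    also have "\<dots> = e * ln (real z) + 2 * e" by (simp add: algebra_simps)
    finally show "exp (e * (\<Sum>p\<in>big_primes z. ln (real p) / real p)) \<le> exp 3" using assms by simp
  qed (use Q_pos[of e z] in simp)
  finally have big: "(\<Prod>p\<in>big_primes z. 1 + 1 / real p) \<le> 1 / Q e z * exp 3" .
  have "(\<Prod>p\<in>?small. 1 + 1 / real p) * (\<Prod>p\<in>big_primes z. 1 + 1 / real p) \<le> 2 ^ y0 * (1 / Q e z * exp 3)"
    using small big by (rule mult_mono) (auto intro: prod_nonneg)
  with total have "ln (real z) \<le> 2 * (2 ^ y0 * (1 / Q e z * exp 3))" by linarith
  moreover have "ln (real z) > 0" using assms by simp
  ultimately show ?thesis using Q_pos[of e z] by (simp add: field_simps)
qed

text \<open>\<open>K\<close> and \<open>\<delta>\<close> are chosen so that each tail takes at most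
  1/8 of the mean excess 1/2, leaving 1/4 in the middle. There the weight is O(e/n), because Q is
  O(e), while the excess is at most K/e: the powers of e cancel and a sum of 1/n remains.\<close>

lemma sum_inverse_chains_ge:
  "\<exists>\<delta> K c e0 :: real. 0 < \<delta> \<and> 0 < K \<and> 0 < c \<and> 0 < e0 \<and> (\<forall>e. 0 < e \<longrightarrow> e \<le> e0 \<longrightarrow>
     (\<exists>y. c \<le> (\<Sum>n\<in>{n \<in> chains y. \<delta> / e < ln (real n) \<and> ln (real n) \<le> K / e}. 1 / real n)))"
proof -
  define A where "A = ln (real N) + 4"
  have A: "A \<ge> 166" using ln_N_ge by (simp add: A_def)
  define K where "K = 2 * ln (16 * exp 6 * A) + 4"
  have arg: "16 * exp 6 * A \<ge> 1"
  proof -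
    have "1 * 1 * 1 \<le> 16 * exp 6 * A" using A by (intro mult_mono) auto
    then show ?thesis by simp
  qed
  have K: "K \<ge> 4" using arg by (simp add: K_def)
  have "- K / 2 \<le> - ln (16 * exp 6 * A)" by (simp add: K_def)
  then have "exp (- K / 2) \<le> exp (- ln (16 * exp 6 * A))" by (simp only: exp_le_cancel_iff)
  also have "\<dots> = 1 / (16 * exp 6 * A)" using arg A by (simp add: exp_minus field_simps)
  finally have "2 * exp 6 * exp (- K / 2) * A \<le> 2 * exp 6 * (1 / (16 * exp 6 * A)) * A"
    using A by (intro mult_right_mono mult_left_mono) auto
  then have Ksmall: "2 * exp 6 * exp (- K / 2) * A \<le> 1 / 8" using A by simp
  define \<delta> where "\<delta> = 1 / (48 * A)"
  have \<delta>: "0 < \<delta>" "\<delta> \<le> 1" using A by (simp_all add: \<delta>_def)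
  define B where "B = 2 ^ (y0 + 1) * exp (3 :: real)"
  have B: "B > 0" by (simp add: B_def)
  define c where "c = \<delta> / (8 * B * K)"
  have c: "c > 0" using \<delta> B K by (simp add: c_def)
  \<comment> \<open>The first bound gives \<open>\<delta> / e \<ge> 2\<close>, so that z below is at
    least 2; the second gives the smallness condition of \<open>sum_wt_excess_ge\<close>.\<close>
  define e0 where "e0 = min (\<delta> / 2) (1 / (2 * A * A))"
  have e0: "e0 > 0" using \<delta> A by (simp add: e0_def)
  have main: "\<exists>y. c \<le> (\<Sum>n\<in>{n \<in> chains y. \<delta> / e < ln (real n) \<and> ln (real n) \<le> K / e}. 1 / real n)"
    if e: "0 < e" "e \<le> e0" for e
  proof -
    have ed: "e \<le> \<delta> / 2" and eA: "e * (2 * A * A) \<le> 1"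
      using e A by (auto simp: e0_def field_simps)
    have e1: "e \<le> 1" using ed \<delta> by simp
    have "2 * (ln (real N) + 4) * (1 + ln (real N)) * e \<le> 2 * A * A * e"
      unfolding A_def using ln_N_ge e by (intro mult_right_mono mult_mono) auto
    then have eN: "2 * (ln (real N) + 4) * (1 + ln (real N)) * e \<le> 1"
      using eA by (simp only: mult.commute[of e])
    \<comment> \<open>The second entry of the maximum ensures y^(-e) <= e.\<close>
    obtain y :: nat where y: "max (real N * exp (2 / e)) ((1 / e) powr (1 / e)) \<le> real y"
      using real_arch_simple by blast
    have yN: "real N * exp (2 / e) \<le> real y" using y by simp
    have "1 * 1 \<le> real N * exp (2 / e)" using N_pos e by (intro mult_mono) auto
    with yN have y1: "y \<ge> 1" by simp
    have "real y powr -e \<le> ((1 / e) powr (1 / e)) powr -e"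
      using e y by (intro powr_mono2') auto
    also have "\<dots> = e" using e by (simp add: powr_powr powr_minus)
    finally have ye: "real y powr -e \<le> e" .
    let ?w = "\<lambda>n. wt e y n * excess e (ln (real n))"
    \<comment> \<open>The larger exponent for \<open>small_tail\<close> is
      \<open>e / \<delta>\<close>, whose scale is the lower end \<open>\<delta> / e\<close> of the
      middle range.\<close>
    let ?small = "{n \<in> chains y. ln (real n) \<le> 1 / (e / \<delta>)}"
    let ?large = "{n \<in> chains y. K / e < ln (real n)}"
    let ?mid = "{n \<in> chains y. \<delta> / e < ln (real n) \<and> ln (real n) \<le> K / e}"
    have w0: "?w n \<ge> 0" for n using wt_nonneg excess_nonneg[OF e(1)] by simp
    have union: "sum ?w (X \<union> Y) \<le> sum ?w X + sum ?w Y" if "finite X" "finite Y" for X Y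
      using sum.union_inter[OF that, of ?w] sum_nonneg[of "X \<inter> Y" ?w] w0 by simp
    have "1 / 2 \<le> (\<Sum>n\<in>chains y. ?w n)" using e(1) eN ye yN by (rule sum_wt_excess_ge)
    also have "\<dots> \<le> (\<Sum>n\<in>?mid \<union> (?small \<union> ?large). ?w n)"
      using w0 by (intro sum_mono2) auto
    also have "\<dots> \<le> (\<Sum>n\<in>?mid. ?w n) + (\<Sum>n\<in>?small \<union> ?large. ?w n)"
      by (intro union) auto
    also have "(\<Sum>n\<in>?small \<union> ?large. ?w n) \<le> (\<Sum>n\<in>?small. ?w n) + (\<Sum>n\<in>?large. ?w n)"
      by (intro union) auto
    also have "(\<Sum>n\<in>?large. ?w n) \<le> 1 / 8"
      using large_tail[OF e(1) e1 K y1] Ksmall by (simp add: A_def)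
    also have "(\<Sum>n\<in>?small. ?w n) \<le> 1 / 8"
    proof -
      have "e * \<delta> \<le> e * 1" using e \<delta> by (intro mult_left_mono) auto
      then have "e \<le> e / \<delta>" using \<delta> by (simp add: field_simps)
      from small_tail[OF e(1) this y1] have "(\<Sum>n\<in>?small. ?w n) \<le> 6 * (e / (e / \<delta>)) * A"
        by (simp add: A_def)
      also have "\<dots> = 6 * \<delta> * A" using e by simp
      also have "\<dots> = 1 / 8" using A by (simp add: \<delta>_def)
      finally show ?thesis .
    qed
    finally have mid: "1 / 4 \<le> (\<Sum>n\<in>?mid. ?w n)" by simp
    \<comment> \<open>On the middle range both N n and y are at least z, so \<open>Q e z\<close>
      bounds every Q that occurs. Rounding down loses at most a factor 2.\<close>
    define z where "z = nat \<lfloor>exp (\<delta> / e)\<rfloor>"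
    have de: "2 \<le> \<delta> / e" using ed e by (simp add: field_simps)
    have "1 \<le> exp (\<delta> / e)" using de by simp
    then have "1 \<le> \<lfloor>exp (\<delta> / e)\<rfloor>" by (simp only: one_le_floor)
    moreover from this have "real z = of_int \<lfloor>exp (\<delta> / e)\<rfloor>" by (simp add: z_def)
    ultimately have zr: "exp (\<delta> / e) \<le> 2 * real z" "real z \<le> exp (\<delta> / e)" "1 \<le> real z" by linarith+
    have "\<delta> / e = ln (exp (\<delta> / e))" by simp
    also have "\<dots> \<le> ln (2 * real z)" using zr(1) by (intro ln_mono) auto
    also have "\<dots> = ln 2 + ln (real z)" using zr(3) by (intro ln_mult_pos) auto
    finally have "\<delta> / e - 1 \<le> ln (real z)" using ln_le_minus_one[of 2] by simp
    moreover have "r - 1 \<le> l \<Longrightarrow> 2 \<le> r \<Longrightarrow> r / 2 \<le> l" for r l :: real by simp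
    ultimately have lnz: "\<delta> / e / 2 \<le> ln (real z)" using de by blast
    have "1 \<le> \<delta> / e / 2" using de by simp
    then have lnz1: "1 \<le> ln (real z)" using lnz by (rule order_trans)
    have "z \<noteq> 1" using lnz1 by (intro notI) simp
    with zr(3) have z2: "z \<ge> 2" by linarith
    have "ln (real z) \<le> \<delta> / e" using zr by (metis ln_exp ln_mono less_le_trans zero_less_one)
    then have "e * ln (real z) \<le> e * (\<delta> / e)" using e by (intro mult_left_mono) auto
    then have ez: "e * ln (real z) \<le> 1" using e \<delta> by simp
    have "Q e z \<le> B / ln (real z)" unfolding B_def using e z2 ez e1 by (intro Q_le) auto
    also have "\<dots> \<le> B / (\<delta> / e / 2)" using lnz lnz1 B \<delta> e by (intro divide_left_mono mult_pos_pos) auto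
    finally have Qz: "Q e z \<le> 2 * B * e / \<delta>" by (simp add: field_simps)
    have "(\<Sum>n\<in>?mid. ?w n) \<le> (\<Sum>n\<in>?mid. 2 * B * K / \<delta> * (1 / real n))"
    proof (rule sum_mono)
      fix n assume n: "n \<in> ?mid"
      then have n1: "n \<ge> 1" using chains_pos by auto
      have "exp (\<delta> / e) \<le> exp (ln (real n))" using n by (simp only: exp_le_cancel_iff) simp
      then have "real z \<le> real n" using zr n1 by simp
      then have "z \<le> n" by simp
      also have "n \<le> N * n" using mult_le_mono1[OF N_pos, of n] by simp
      finally have "z \<le> N * n" .
      moreover have "z \<le> y"
      proof -
        have "1 * exp (\<delta> / e) \<le> real N * exp (2 / e)"
          using N_pos \<delta> e by (intro mult_mono) (auto intro: divide_right_mono)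
        then have "real z \<le> real y" using zr yN by simp
        then show ?thesis by simp
      qed
      ultimately have "z \<le> min (N * n) y" by simp
      then have "Q e (min (N * n) y) \<le> 2 * B * e / \<delta>" using Q_antimono Qz order_trans by blast
      moreover have "real n powr -(1 + e) \<le> real n powr -1" using n1 e by (intro powr_mono) auto
      moreover have "real n powr -1 = 1 / real n" using n1 by (simp add: powr_minus_divide)
      ultimately have "wt e y n \<le> 1 / real n * (2 * B * e / \<delta>)"
        unfolding wt_def using Q_pos[of e "min (N * n) y"] by (intro mult_mono) auto
      moreover have "excess e (ln (real n)) \<le> K / e"
        using excess_le_self[of e "ln (real n)"] e n n1 by simp
      ultimately have "?w n \<le> (1 / real n * (2 * B * e / \<delta>)) * (K / e)"
        using excess_nonneg[OF e(1)] B \<delta> e by (intro mult_mono) auto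
      also have "\<dots> = 2 * B * K / \<delta> * (1 / real n)" using e by (simp add: mult_ac)
      finally show "?w n \<le> 2 * B * K / \<delta> * (1 / real n)" .
    qed
    also have "\<dots> = 2 * B * K / \<delta> * (\<Sum>n\<in>?mid. 1 / real n)" by (rule sum_distrib_left[symmetric])
    finally have "1 / 4 \<le> 2 * B * K / \<delta> * (\<Sum>n\<in>?mid. 1 / real n)" using mid by linarith
    then have "c \<le> (\<Sum>n\<in>?mid. 1 / real n)" using B K \<delta> by (simp add: c_def field_simps)
    then show ?thesis by blast
  qed
  show ?thesis using \<delta> K c e0 main by (intro exI[of _ \<delta>] exI[of _ K] exI[of _ c] exI[of _ e0]) auto
qed

end

section \<open>Spreading the logarithmic density\<close>

lemma primorial_dense:
  "y \<ge> 3 \<Longrightarrow> densely_divisible (\<Prod>{p. prime p \<and> p \<le> y})"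
proof (induction y rule: dec_induct)
  case base
  have "{p::nat. prime p \<and> p \<le> 3} = {2, 3}"
  proof -
    have "p = 2 \<or> p = 3" if "prime p" "p \<le> 3" for p :: nat
      using that prime_ge_2_nat[of p] by linarith
    then show ?thesis by auto
  qed
  then show ?case using densely_divisible_6 by simp
next
  case (step y)
  let ?N = "\<Prod>{p. prime p \<and> p \<le> y}"
  have dvd: "p \<le> y \<longleftrightarrow> p dvd ?N" if prime: "prime p" for p
  proof
    show "p dvd ?N" if "p \<le> y" using that prime by (intro dvd_prodI) auto
    assume "p dvd ?N"
    then obtain q where "q \<in> {p. prime p \<and> p \<le> y}" "p dvd q"
      using prime by (auto simp: prime_dvd_prod_iff)
    then show "p \<le> y" using prime primes_dvd_imp_eq by auto
  qed
  show ?case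
  proof (cases "prime (Suc y)")
    case True
    \<comment> \<open>Euclid's argument replaces any bound on prime gaps: a prime factor of N - 1
      does not divide N, so it exceeds y, and therefore \<open>Suc y < ?N\<close>. Excluding N = 2
      ensures that N - 1 has a prime factor.\<close>
    have "?N \<noteq> 2"
      using dvd[of 3] step.hyps by (auto simp del: One_nat_def)
    moreover have "?N > 1" using step.IH by (simp add: densely_divisible_def)
    ultimately have "?N - 1 \<noteq> 1" by simp
    then obtain q where q: "prime q" "q dvd ?N - 1" using prime_factor_nat by blast
    have "\<not> q dvd ?N"
    proof
      assume "q dvd ?N"
      then have "q dvd ?N - (?N - 1)" using q(2) by (rule dvd_diff_nat)
      then show False using q(1) \<open>?N > 1\<close> by simp
    qed
    then have "Suc y \<le> q" using dvd[OF q(1)] by simp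
    also have "q \<le> ?N - 1" using q(2) \<open>?N > 1\<close> by (intro dvd_imp_le) auto
    also have "\<dots> < ?N" using \<open>?N > 1\<close> by simp
    finally have "densely_divisible (?N * Suc y)"
      using step.IH True dvd[OF True] by (intro densely_divisible_mult_prime) auto
    then show ?thesis using True by (simp add: primes_le_Suc mult.commute del: mult_Suc_right mult_Suc)
  qed (use step.IH in \<open>simp add: primes_le_Suc\<close>)
qed

lemma prime_seed_exists: "\<exists>y0 N. prime_seed y0 N"
proof -
  have "((\<lambda>x::real. ln x / x) \<longlongrightarrow> 0) at_top" by (rule ln_x_over_x_tendsto_0)
  \<comment> \<open>Here 36 = 2 * 18, and 324 below is 2 * 162: each half of 18 (ln y + 9) gets half
    of y / exp 7, a lower bound for the log of the primorial.\<close>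
  then have "eventually (\<lambda>x::real. ln x / x < 1 / (36 * exp 7)) at_top"
    by (rule order_tendstoD) simp
  then obtain X :: real where X: "\<And>x. x \<ge> X \<Longrightarrow> ln x / x < 1 / (36 * exp 7)"
    by (auto simp: eventually_at_top_linorder)
  obtain y :: nat where y: "max X (324 * exp 7) \<le> real y" using real_arch_simple by blast
  have y7: "exp 7 \<le> real y" "324 * exp 7 \<le> real y" using y by (auto intro: order_trans[rotated])
  have ypos: "real y > 0" using y7(1) by (rule less_le_trans[rotated]) simp
  have "(3 :: real) \<le> 324 * exp 7"
  proof -
    have "(3::real) * 1 \<le> 324 * exp 7" by (intro mult_mono) auto
    then show ?thesis by simp
  qed
  then have y3: "y \<ge> 3" using y7(2) by linarith
  let ?N = "\<Prod>{p. prime p \<and> p \<le> y}"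
  have "ln (real y) / real y < 1 / (36 * exp 7)" using X y by simp
  then have "36 * ln (real y) \<le> real y / exp 7" using ypos by (simp add: field_simps)
  moreover have "324 \<le> real y / exp 7" using y7(2) by (simp add: field_simps)
  ultimately have "18 * (ln (real y) + 9) \<le> real y / exp 7" by simp
  also have "\<dots> \<le> (\<Sum>p | prime p \<and> real y / exp 7 < real p \<and> real p \<le> real y. ln (real p))"
    using y7(1) by (rule theta_interval_ge)
  also have "\<dots> \<le> (\<Sum>p | prime p \<and> p \<le> y. ln (real p))"
    by (intro sum_mono2) (auto simp: Suc_le_eq dest: prime_gt_0_nat)
  also have "\<dots> = ln (\<Prod>p | prime p \<and> p \<le> y. real p)"
    by (rule ln_prod[symmetric]) (auto dest: prime_gt_0_nat)
  also have "(\<Prod>p | prime p \<and> p \<le> y. real p) = real ?N" by simp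
  finally have "18 * (ln (real y) + 9) \<le> ln (real ?N)" .
  moreover have "p \<le> y" if p: "prime p" "p dvd ?N" for p
  proof -
    obtain q where "q \<in> {p. prime p \<and> p \<le> y}" "p dvd q"
      using p by (auto simp: prime_dvd_prod_iff)
    then show ?thesis using p primes_dvd_imp_eq by auto
  qed
  ultimately have "prime_seed y ?N"
    using y3 primorial_dense[OF y3] by unfold_locales auto
  then show ?thesis by blast
qed

section \<open>Multiplicity of products\<close>

lemma card_large_prime_divisors:
  assumes "m \<ge> 1" "z > 1"
  shows "finite {p. prime p \<and> p dvd m \<and> z < real p}"
    and "real (card {p. prime p \<and> p dvd m \<and> z < real p}) \<le> ln (real m) / ln z"
proof -
  let ?P = "{p. prime p \<and> p dvd m \<and> z < real p}"
  show fin: "finite ?P"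
    by (rule finite_subset[of _ "{..m}"]) (use assms in \<open>auto dest: dvd_imp_le\<close>)
  have "\<Prod>?P dvd m" using fin by (intro prod_primes_dvd_nat) auto
  then have "\<Prod>?P \<le> m" using assms by (intro dvd_imp_le) auto
  then have "real (\<Prod>?P) \<le> real m" by (simp only: of_nat_le_iff)
  moreover have "z ^ card ?P \<le> (\<Prod>p\<in>?P. real p)"
    unfolding prod_constant[symmetric] using assms by (intro prod_mono) auto
  ultimately have "z ^ card ?P \<le> real m" by simp
  then have "ln (z ^ card ?P) \<le> ln (real m)" using assms by (intro ln_mono) auto
  then show "real (card ?P) \<le> ln (real m) / ln z" using assms by (simp add: ln_realpow field_simps)
qed

text \<open>A pair is determined by its product m and the prime p, one of at most ln m / ln z prime
  divisors above z. When z is a fixed power of M, passing from pairs to distinct products costs only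
  a constant.\<close>

lemma sum_products_le:
  fixes h :: "nat \<Rightarrow> real" and W :: "(nat \<times> nat) set"
  assumes W: "finite W" "\<And>n p. (n, p) \<in> W \<Longrightarrow> prime p \<and> z < real p \<and> n \<ge> 1 \<and> real (n * p) \<le> M"
    and z: "z > 1" and h: "\<And>m. h m \<ge> 0"
  shows "(\<Sum>(n, p)\<in>W. h (n * p)) \<le> ln M / ln z * (\<Sum>m\<in>(\<lambda>(n, p). n * p) ` W. h m)"
proof -
  let ?f = "\<lambda>(n, p). n * p :: nat"
  have "(\<Sum>(n, p)\<in>W. h (n * p)) = (\<Sum>m\<in>?f ` W. \<Sum>x\<in>{x \<in> W. ?f x = m}. case x of (n, p) \<Rightarrow> h (n * p))"
    using W(1) by (rule sum.image_gen)
  also have "\<dots> \<le> (\<Sum>m\<in>?f ` W. ln M / ln z * h m)"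
  proof (rule sum_mono)
    fix m assume "m \<in> ?f ` W"
    then obtain n p where np: "(n, p) \<in> W" "m = n * p" by auto
    have p0: "prime p" "n \<ge> 1" "real m \<le> M" using W(2)[OF np(1)] np(2) by auto
    then have m1: "m \<ge> 1" using np(2) prime_gt_0_nat[of p] by (simp add: Suc_le_eq)
    let ?A = "{x \<in> W. ?f x = m}" and ?P = "{p. prime p \<and> p dvd m \<and> z < real p}"
    have "(\<Sum>x\<in>?A. case x of (n, p) \<Rightarrow> h (n * p)) = (\<Sum>x\<in>?A. h m)"
      by (rule sum.cong) auto
    then have eq: "(\<Sum>x\<in>?A. case x of (n, p) \<Rightarrow> h (n * p)) = real (card ?A) * h m" by simp
    have "card ?A \<le> card ?P"
    proof (rule card_inj_on_le)
      show "inj_on snd ?A"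
      proof (rule inj_onI)
        fix x y assume x: "x \<in> ?A" and y: "y \<in> ?A" and eq: "snd x = snd y"
        obtain a b c where xy: "x = (a, b)" "y = (c, b)" using eq by (cases x; cases y) auto
        then have "prime b" "a * b = c * b" using x y W(2)[of a b] by auto
        then show "x = y" using xy prime_gt_0_nat[of b] by simp
      qed
      show "snd ` ?A \<subseteq> ?P" using W(2) by auto
      show "finite ?P" using m1 z by (rule card_large_prime_divisors)
    qed
    then have "real (card ?A) \<le> real (card ?P)" by simp
    also have "\<dots> \<le> ln (real m) / ln z" using m1 z by (rule card_large_prime_divisors)
    also have "\<dots> \<le> ln M / ln z" using m1 z p0 by (intro divide_right_mono ln_mono) auto
    finally have "real (card ?A) * h m \<le> ln M / ln z * h m" by (rule mult_right_mono[OF _ h])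
    then show "(\<Sum>x\<in>?A. case x of (n, p) \<Rightarrow> h (n * p)) \<le> ln M / ln z * h m"
      by (simp only: eq)
  qed
  also have "\<dots> = ln M / ln z * (\<Sum>m\<in>?f ` W. h m)" by (rule sum_distrib_left[symmetric])
  finally show ?thesis .
qed

section \<open>Moving windows of logarithmic density\<close>

definition dense_window :: "real \<Rightarrow> real \<Rightarrow> real \<Rightarrow> nat set" where
  "dense_window x u v = {n. densely_divisible n \<and> x powr u < real n \<and> real n \<le> x powr v}"

text \<open>A constant is the expected order: a set of density 1/log t has reciprocal sum about ln
  (v/u) between x^u and x^v.\<close>

definition log_dense :: "real \<Rightarrow> real \<Rightarrow> bool" where
  "log_dense u v \<longleftrightarrow> (\<exists>c>0. \<exists>x0. \<forall>x\<ge>x0. c \<le> (\<Sum>n\<in>dense_window x u v. 1 / real n))"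

lemma finite_dense_window [simp]: "finite (dense_window x u v)"
proof (rule finite_subset)
  show "dense_window x u v \<subseteq> {..nat \<lfloor>x powr v\<rfloor>}" by (auto simp: dense_window_def le_nat_floor)
qed simp

lemma dense_window_pos: "n \<in> dense_window x u v \<Longrightarrow> n \<ge> 1"
  by (simp add: dense_window_def densely_divisible_def)

text \<open>With e = k / ln x the scale 1/e becomes a fixed power of x. The choice k = 5 (K + 1)
  puts the upper end at x^(1/5), with room for the factor N, since ln N <= 1/e for large x.\<close>

lemma log_dense_initial: "\<exists>a. 0 < a \<and> a \<le> 1 / 10 \<and> log_dense a (1 / 5)"
proof -
  obtain y0 N where "prime_seed y0 N" using prime_seed_exists by blast
  then interpret prime_seed y0 N .
  obtain \<delta> K c e0 :: real where pos: "0 < \<delta>" "0 < K" "0 < c" "0 < e0"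
    and main: "\<And>e. 0 < e \<Longrightarrow> e \<le> e0 \<Longrightarrow>
      \<exists>y. c \<le> (\<Sum>n\<in>{n \<in> chains y. \<delta> / e < ln (real n) \<and> ln (real n) \<le> K / e}. 1 / real n)"
    using sum_inverse_chains_ge by blast
  define k where "k = 5 * (K + 1)"
  have k: "k > 0" using pos by (simp add: k_def)
  define a where "a = min (\<delta> / k) (1 / 10)"
  have a: "0 < a" "a \<le> 1 / 10" unfolding a_def using pos k by (simp, intro min.cobounded2)
  have "c / real N \<le> (\<Sum>m\<in>dense_window x a (1 / 5). 1 / real m)"
    if x: "x \<ge> exp (k / e0 + k * ln (real N) + 1)" for x
  proof -
    have x0: "x > 0" using x by (rule less_le_trans[rotated]) simp
    have "ln (exp (k / e0 + k * ln (real N) + 1)) \<le> ln x" using x by (intro ln_mono) auto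
    then have lnx: "k / e0 + k * ln (real N) + 1 \<le> ln x" by simp
    have nn: "0 \<le> k / e0" "0 \<le> k * ln (real N)" using k pos ln_N_ge by simp_all
    define e where "e = k / ln x"
    have lnx0: "ln x > 0" using lnx nn by linarith
    have e: "e > 0" "ln x = k / e" using k lnx0 by (simp_all add: e_def)
    have "k / e0 \<le> ln x" using lnx nn by linarith
    then have "e \<le> e0" using pos lnx0 by (simp add: e_def field_simps)
    from main[OF e(1) this] obtain y where
      y: "c \<le> (\<Sum>n\<in>{n \<in> chains y. \<delta> / e < ln (real n) \<and> ln (real n) \<le> K / e}. 1 / real n)" by blast
    let ?C = "{n \<in> chains y. \<delta> / e < ln (real n) \<and> ln (real n) \<le> K / e}"
    have "k * ln (real N) \<le> k / e" using lnx nn e by linarith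
    then have eN: "ln (real N) \<le> 1 / e" using k e by (simp add: field_simps)
    have sub: "(*) N ` ?C \<subseteq> dense_window x a (1 / 5)"
    proof
      fix m assume "m \<in> (*) N ` ?C"
      then obtain n where n: "n \<in> chains y" "\<delta> / e < ln (real n)" "ln (real n) \<le> K / e" "m = N * n" by auto
      have n1: "n \<ge> 1" using chains_pos[OF n(1)] .
      have m1: "real m > 0" using n n1 N_pos by simp
      have lnm: "ln (real m) = ln (real N) + ln (real n)"
        unfolding n(4) of_nat_mult using n1 N_pos by (intro ln_mult_pos) auto
      have "a * ln x \<le> \<delta> / k * ln x" using lnx0 by (intro mult_right_mono) (auto simp: a_def)
      also have "\<dots> = \<delta> / e" using e k by simp
      also have "\<dots> < ln (real m)" using n(2) lnm ln_N_ge by simp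
      finally have "exp (a * ln x) < exp (ln (real m))" by simp
      then have lo: "x powr a < real m" using m1 x0 by (simp add: powr_def)
      have "ln (real m) \<le> 1 / e + K / e" using lnm n(3) eN by simp
      also have "\<dots> = 1 / 5 * ln x" using e by (simp add: k_def field_simps)
      finally have "exp (ln (real m)) \<le> exp (1 / 5 * ln x)" by (simp only: exp_le_cancel_iff)
      then have "real m \<le> x powr (1 / 5)" using m1 x0 by (simp add: powr_def)
      then show "m \<in> dense_window x a (1 / 5)"
        using lo chains_dense[OF n(1)] n(4) by (simp add: dense_window_def)
    qed
    have "c / real N \<le> (\<Sum>n\<in>?C. 1 / real n) / real N" using y by (intro divide_right_mono) auto
    also have "\<dots> = (\<Sum>n\<in>?C. 1 / real (N * n))" by (simp add: sum_divide_distrib mult.commute)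
    also have "\<dots> = (\<Sum>m\<in>(*) N ` ?C. 1 / real m)"
      using N_pos by (subst sum.reindex) (auto simp: inj_on_def)
    also have "\<dots> \<le> (\<Sum>m\<in>dense_window x a (1 / 5). 1 / real m)" using sub by (intro sum_mono2) auto
    finally show ?thesis .
  qed
  moreover have "c / real N > 0" using pos N_pos by simp
  ultimately show ?thesis using a unfolding log_dense_def by blast
qed

text \<open>Attach one prime from (x^(3a/4), x^a]. Because a <= u it is smaller than n, so density
  of divisors persists; the multiplicity of a product is at most 8/(3a).\<close>

lemma log_dense_step:
  assumes a: "0 < a" "a \<le> 1" and uv: "a \<le> u" "v \<le> 1" and "log_dense u v"
  shows "log_dense (u + 3 * a / 4) (v + a)"
proof -
  obtain c x0 where c: "c > 0" and x0: "\<And>x. x \<ge> x0 \<Longrightarrow> c \<le> (\<Sum>n\<in>dense_window x u v. 1 / real n)"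
    using assms(5) unfolding log_dense_def by blast
  have "3 * a / 8 * (c / 16) \<le> (\<Sum>m\<in>dense_window x (u + 3 * a / 4) (v + a). 1 / real m)"
    if x: "x \<ge> max x0 (exp (48 / a ^ 2))" for x
  proof -
    have xe: "x \<ge> exp (48 / a ^ 2)" using x by simp
    have xpos: "x > 0" using xe by (rule less_le_trans[rotated]) simp
    have "ln (exp (48 / a ^ 2)) \<le> ln x" using xe by (intro ln_mono) auto
    \<comment> \<open>As a <= 1 this also gives a ln x >= 48, so the error 6 in Mertens' bound is at
      most half of (a ln x)/4. It further yields a lo >= 36, so the primes dividing n contribute at
      most 1/27 to the sum of 1/p.\<close>
    then have L2: "48 \<le> a ^ 2 * ln x" using a by (simp add: field_simps)
    have lnx0: "ln x > 0"
    proof (rule ccontr)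
      assume "\<not> ln x > 0"
      then have "a ^ 2 * ln x \<le> 0" using a by (simp add: mult_nonneg_nonpos)
      with L2 show False by simp
    qed
    then have x1: "x > 1" using xpos by simp
    have "a * (a * ln x) \<le> 1 * (a * ln x)" using a lnx0 by (intro mult_right_mono) auto
    then have L1: "48 \<le> a * ln x" using L2 by (simp add: power2_eq_square mult.assoc)
    define lo where "lo = x powr (3 * a / 4)"
    define z where "z = x powr a"
    have lnlo: "ln lo = 3 * a / 4 * ln x" and lnz: "ln z = a * ln x"
      using xpos by (simp_all add: lo_def z_def ln_powr)
    have lo1: "lo > 1" using x1 a by (simp add: lo_def)
    have loz: "lo \<le> z" unfolding lo_def z_def using x1 a by (intro powr_mono) auto
    have z1: "z > 1" using lo1 loz by simp
    have "3 * a / 4 * ln x \<le> 1 + 3 * a / 4 * ln x" by simp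
    also have "\<dots> \<le> exp (3 * a / 4 * ln x)" by (rule exp_ge_add_one_self)
    also have "\<dots> = lo" using xpos by (simp add: lo_def powr_def)
    finally have "a * (3 * a / 4 * ln x) \<le> a * lo" using a by (intro mult_left_mono) auto
    moreover have "a * (3 * a / 4 * ln x) = 3 / 4 * (a ^ 2 * ln x)" by (simp add: power2_eq_square)
    moreover have "36 \<le> 3 / 4 * (a ^ 2 * ln x)" using L2 by (simp add: mult.commute)
    ultimately have alo: "36 \<le> a * lo" by linarith
    let ?I = "{p. prime p \<and> lo < real p \<and> real p \<le> z}"
    have "ln (z / lo) - 6 \<le> (\<Sum>p\<in>?I. ln (real p) / real p)" using lo1 loz by (intro mertens_interval) auto
    also have "\<dots> \<le> (\<Sum>p\<in>?I. ln z * (1 / real p))"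
    proof (rule sum_mono)
      fix p assume p: "p \<in> ?I"
      then have "real p > 0" using lo1 by auto
      then have "ln (real p) * (1 / real p) \<le> ln z * (1 / real p)"
        using p by (intro mult_right_mono ln_mono) auto
      then show "ln (real p) / real p \<le> ln z * (1 / real p)" by simp
    qed
    also have "\<dots> = ln z * (\<Sum>p\<in>?I. 1 / real p)" by (rule sum_distrib_left[symmetric])
    also have "ln (z / lo) - 6 = a * ln x / 4 - 6" using lo1 z1 by (simp add: ln_div lnlo lnz)
    finally have "a * ln x / 4 - 6 \<le> (a * ln x) * (\<Sum>p\<in>?I. 1 / real p)" by (simp add: lnz)
    moreover have "(a * ln x) * (1 / 8) \<le> a * ln x / 4 - 6" using L1 by simp
    ultimately have "(a * ln x) * (1 / 8) \<le> (a * ln x) * (\<Sum>p\<in>?I. 1 / real p)" by linarith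
    then have I: "1 / 8 \<le> (\<Sum>p\<in>?I. 1 / real p)" using L1 by (subst (asm) mult_le_cancel_left_pos) auto
    let ?R = "\<lambda>n. {p \<in> ?I. \<not> p dvd n}"
    let ?W = "dense_window x u v"
    have R: "1 / 16 \<le> (\<Sum>p\<in>?R n. 1 / real p)" if n: "n \<in> ?W" for n
    proof -
      have n1: "n \<ge> 1" using dense_window_pos[OF n] .
      let ?B = "{p \<in> ?I. p dvd n}" and ?P = "{p. prime p \<and> p dvd n \<and> lo < real p}"
      have "(\<Sum>p\<in>?B. 1 / real p) \<le> (\<Sum>p\<in>?P. 1 / real p)"
        using card_large_prime_divisors(1)[OF n1 lo1] by (intro sum_mono2) auto
      also have "\<dots> \<le> (\<Sum>p\<in>?P. 1 / lo)" using lo1 by (intro sum_mono divide_left_mono) auto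
      also have "\<dots> = real (card ?P) * (1 / lo)" by simp
      also have "real (card ?P) \<le> ln (real n) / ln lo" by (rule card_large_prime_divisors(2)[OF n1 lo1])
      also have "\<dots> \<le> ln x / ln lo"
      proof (intro divide_right_mono ln_mono)
        have "real n \<le> x powr v" using n by (simp add: dense_window_def)
        also have "\<dots> \<le> x powr 1" using x1 uv by (intro powr_mono) auto
        finally show "real n \<le> x" using xpos by simp
      qed (use n1 lo1 in auto)
      also have "ln x / ln lo = 4 / (3 * a)" using lnx0 a by (simp add: lnlo)
      also have "4 / (3 * a) * (1 / lo) = 4 / 3 / (a * lo)" by simp
      also have "\<dots> \<le> 4 / 3 / 36" using alo by (intro divide_left_mono) auto
      also have "\<dots> \<le> 1 / 16" by simp
      finally have "(\<Sum>p\<in>?B. 1 / real p) \<le> 1 / 16" using lo1 by (simp add: divide_right_mono)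
      moreover have "(\<Sum>p\<in>?I. 1 / real p) = (\<Sum>p\<in>?R n. 1 / real p) + (\<Sum>p\<in>?B. 1 / real p)"
        by (subst sum.union_disjoint[symmetric]) (auto intro!: sum.cong finite_subset[OF _ finite_primes_real[of lo z]])
      ultimately show ?thesis using I by simp
    qed
    define V where "V = (SIGMA n:?W. ?R n)"
    let ?f = "\<lambda>(n, p). n * p :: nat"
    have finR: "finite (?R n)" for n by (rule finite_subset[OF _ finite_primes_real[of lo z]]) auto
    have finV: "finite V" unfolding V_def by (intro finite_SigmaI finite_dense_window finR)
    have "c / 16 \<le> (\<Sum>n\<in>?W. 1 / real n) * (1 / 16)" using x0[of x] x by simp
    also have "\<dots> = (\<Sum>n\<in>?W. 1 / real n * (1 / 16))" by (rule sum_distrib_right)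
    also have "\<dots> \<le> (\<Sum>n\<in>?W. 1 / real n * (\<Sum>p\<in>?R n. 1 / real p))"
      using R by (intro sum_mono mult_left_mono) auto
    also have "\<dots> = (\<Sum>n\<in>?W. \<Sum>p\<in>?R n. 1 / real (n * p))" by (simp add: sum_distrib_left)
    also have "\<dots> = (\<Sum>(n, p)\<in>V. 1 / real (n * p))" unfolding V_def using finR by (intro sum.Sigma) auto
    also have "\<dots> \<le> ln (x powr (v + a)) / ln lo * (\<Sum>m\<in>?f ` V. 1 / real m)"
    proof (rule sum_products_le[OF finV])
      fix n p assume "(n, p) \<in> V"
      then have np: "n \<in> ?W" "p \<in> ?R n" by (auto simp: V_def)
      have "real n * real p \<le> x powr v * x powr a"
        using np by (intro mult_mono) (auto simp: dense_window_def z_def)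
      then show "prime p \<and> lo < real p \<and> n \<ge> 1 \<and> real (n * p) \<le> x powr (v + a)"
        using np dense_window_pos[OF np(1)] by (simp add: powr_add)
    qed (use lo1 in auto)
    also have "\<dots> \<le> 8 / (3 * a) * (\<Sum>m\<in>dense_window x (u + 3 * a / 4) (v + a). 1 / real m)"
    proof (rule mult_mono)
      have "ln (x powr (v + a)) / ln lo = (v + a) * (4 / (3 * a))"
        using lnx0 a xpos by (simp add: lnlo ln_powr)
      also have "\<dots> \<le> 2 * (4 / (3 * a))" using uv a by (intro mult_right_mono) auto
      finally show "ln (x powr (v + a)) / ln lo \<le> 8 / (3 * a)" by simp
      show "(\<Sum>m\<in>?f ` V. 1 / real m) \<le> (\<Sum>m\<in>dense_window x (u + 3 * a / 4) (v + a). 1 / real m)"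
      proof (rule sum_mono2)
        show "?f ` V \<subseteq> dense_window x (u + 3 * a / 4) (v + a)"
        proof
          fix m assume "m \<in> ?f ` V"
          then obtain n p where np: "n \<in> ?W" "p \<in> ?R n" "m = n * p" by (auto simp: V_def)
          have n: "densely_divisible n" "x powr u < real n" "real n \<le> x powr v"
            using np by (auto simp: dense_window_def)
          have p: "prime p" "lo < real p" "real p \<le> z" "\<not> p dvd n" using np by auto
          have "z \<le> x powr u" unfolding z_def using x1 uv by (intro powr_mono) auto
          then have "p < n" using p n by linarith
          then have "densely_divisible m" using n p np(3) by (simp add: densely_divisible_mult_prime)
          moreover have "x powr u * lo < real n * real p"
            using n p lo1 dense_window_pos[OF np(1)] by (intro mult_strict_mono) auto
          moreover have "real n * real p \<le> x powr v * z" using n p by (intro mult_mono) auto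
          ultimately show "m \<in> dense_window x (u + 3 * a / 4) (v + a)"
            by (simp add: dense_window_def np(3) lo_def z_def powr_add)
        qed
      qed auto
    qed (use a in \<open>auto intro!: sum_nonneg\<close>)
    finally show ?thesis using a by (simp add: field_simps)
  qed
  moreover have "3 * a / 8 * (c / 16) > 0" using a c by simp
  ultimately show ?thesis unfolding log_dense_def by blast
qed

text \<open>About 2/(3a) steps of length 3a/4 lift the lower exponent to 1/2, while the upper one
  reaches at most 1/5 + 2/3 + a < 97/100. The ratio 3/4, the start 1/5 and a <= 1/10 are what keep
  it below 1.\<close>

lemma log_dense_upper_half: "\<exists>u v. 1 / 2 \<le> u \<and> v \<le> 97 / 100 \<and> log_dense u v"
proof -
  obtain a where a: "0 < a" "a \<le> 1 / 10" "log_dense a (1 / 5)" using log_dense_initial by blast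
  have iter: "log_dense (a + 3 * a / 4 * real k) (1 / 5 + a * real k)"
    if "1 / 5 + a * real k \<le> 1" for k
    using that
  proof (induction k)
    case (Suc k)
    have le: "1 / 5 + a * real k \<le> 1" using Suc.prems a by (simp add: algebra_simps)
    have "log_dense (a + 3 * a / 4 * real k + 3 * a / 4) (1 / 5 + a * real k + a)"
      using a le Suc.IH[OF le] by (intro log_dense_step) auto
    moreover have "a + 3 * a / 4 * real k + 3 * a / 4 = a + 3 * a / 4 * real (Suc k)"
      "1 / 5 + a * real k + a = 1 / 5 + a * real (Suc k)" by (simp_all add: field_simps)
    ultimately show ?case by (simp only:)
  qed (use a in simp)
  define k where "k = nat \<lceil>2 / (3 * a)\<rceil>"
  have "0 < 2 / (3 * a)" using a by simp
  then have k: "2 / (3 * a) \<le> real k" "real k \<le> 2 / (3 * a) + 1" unfolding k_def by linarith+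
  have "a * real k \<le> a * (2 / (3 * a) + 1)" using k a by (intro mult_left_mono) auto
  also have "\<dots> = 2 / 3 + a" using a by (simp add: field_simps)
  finally have v: "1 / 5 + a * real k \<le> 97 / 100" using a by simp
  have "3 * a / 4 * (2 / (3 * a)) \<le> 3 * a / 4 * real k" using k a by (intro mult_left_mono) auto
  then have u: "1 / 2 \<le> a + 3 * a / 4 * real k" using a by simp
  have "log_dense (a + 3 * a / 4 * real k) (1 / 5 + a * real k)" using v by (intro iter) simp
  with u v show ?thesis by blast
qed

section \<open>From logarithmic density to counting\<close>

lemma D'_ge_eventually: "\<exists>c>0. \<exists>x0. \<forall>x\<ge>x0. c * (x / ln x) \<le> real (D' x)"
proof -
  obtain u v where uv: "1 / 2 \<le> u" "v \<le> 97 / 100" and "log_dense u v"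
    using log_dense_upper_half by blast
  then obtain c x0 where c: "c > 0" and x0: "\<And>x. x \<ge> x0 \<Longrightarrow> c \<le> (\<Sum>n\<in>dense_window x u v. 1 / real n)"
    unfolding log_dense_def by blast
  \<comment> \<open>In the constant, 2 allows for primes dividing n, 100 for multiplicity, and exp 7
    is from \<open>card_primes_interval_ge\<close>. The threshold yields 200 exp 7 ln x <= x^(3/100)
    by a quadratic Taylor bound, as 9/20000 times 500000 is 225.\<close>
  have "c / (200 * exp 7) * (x / ln x) \<le> real (D' x)" if x: "x \<ge> max x0 (exp (500000 * exp 7))" for x
  proof -
    have xe: "x \<ge> exp (500000 * exp 7)" using x by simp
    have xpos: "x > 0" using xe by (rule less_le_trans[rotated]) simp
    have "ln (exp (500000 * exp 7)) \<le> ln x" using xe by (intro ln_mono) auto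
    then have L: "500000 * exp 7 \<le> ln x" by simp
    have "(1::real) \<le> exp 7" by simp
    then have L5: "500000 \<le> ln x" using L by linarith
    then have "ln x > 0" by linarith
    then have x1: "x > 1" using ln_gt_zero_iff[OF xpos] by blast
    have powr_exp: "x powr t = exp (t * ln x)" for t using xpos by (simp add: powr_def)
    define lo where "lo = x powr (1 / 100)"
    have lnlo: "ln lo = ln x / 100" using xpos by (simp add: lo_def ln_powr)
    have lo1: "lo > 1" using x1 by (simp add: lo_def)
    define t where "t = 3 / 100 * ln x"
    have "200 * exp 7 * ln x \<le> 9 / 20000 * (500000 * exp 7 * ln x)" using L5 by simp
    also have "\<dots> \<le> 9 / 20000 * (ln x * ln x)" using L L5 by (intro mult_left_mono mult_right_mono) auto
    also have "\<dots> = t ^ 2 / 2" by (simp add: t_def power2_eq_square)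
    also have "\<dots> \<le> 1 + t + t ^ 2 / 2" using L5 by (simp add: t_def)
    also have "\<dots> \<le> exp t" using L5 by (intro exp_lower_Taylor_quadratic) (simp add: t_def)
    also have "\<dots> = x powr (3 / 100)" by (simp add: powr_exp t_def)
    finally have big: "200 * exp 7 * ln x \<le> x powr (3 / 100)" .
    let ?W = "dense_window x u v"
    \<comment> \<open>Since n > x^(1/2), such a prime satisfies p <= x/n < n; since n <= x^(97/100),
      it exceeds x^(1/100).\<close>
    let ?I = "\<lambda>n. {p. prime p \<and> x / real n / exp 7 < real p \<and> real p \<le> x / real n}"
    let ?R = "\<lambda>n. {p \<in> ?I n. \<not> p dvd n}"
    have finR: "finite (?R n)" for n by (rule finite_subset[OF _ finite_primes_real[of "x / real n / exp 7" "x / real n"]]) auto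
    have nfacts: "real n > 0 \<and> x powr (3 / 100) \<le> x / real n \<and> x / real n < real n \<and> real n \<le> x" if n: "n \<in> ?W" for n
    proof -
      have n1: "n \<ge> 1" using dense_window_pos[OF n] .
      have "real n \<le> x powr v" using n by (simp add: dense_window_def)
      also have "\<dots> \<le> x powr (97 / 100)" using x1 uv by (intro powr_mono) auto
      finally have "real n * x powr (3 / 100) \<le> x powr (97 / 100) * x powr (3 / 100)"
        by (intro mult_right_mono) auto
      also have "\<dots> = x" using xpos by (simp flip: powr_add)
      finally have up: "real n * x powr (3 / 100) \<le> x" .
      have "x powr (1 / 2) \<le> x powr u" using x1 uv by (intro powr_mono) auto
      also have "\<dots> < real n" using n by (simp add: dense_window_def)
      finally have "x powr (1 / 2) * x powr (1 / 2) < real n * real n"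
        using n1 by (intro mult_strict_mono) auto
      moreover have "x powr (1 / 2) * x powr (1 / 2) = x" using xpos by (simp flip: powr_add)
      ultimately have lw: "x < real n * real n" by simp
      have "1 \<le> x powr (3 / 100)" using x1 by (intro ge_one_powr_ge_zero) auto
      then have "real n * 1 \<le> real n * x powr (3 / 100)" by (intro mult_left_mono) auto
      then have "real n \<le> x" using up by simp
      then show ?thesis using up lw n1 by (simp add: field_simps)
    qed
    have lower: "lo \<le> x / real n / exp 7" and z7: "exp 7 \<le> x / real n" if n: "n \<in> ?W" for n
    proof -
      have "exp 7 \<le> exp (2 / 100 * ln x)" using L5 by (simp only: exp_le_cancel_iff)
      then have "lo * exp 7 \<le> lo * x powr (2 / 100)"
        using lo1 by (simp add: powr_exp)
      also have "\<dots> = x powr (3 / 100)" by (simp add: lo_def flip: powr_add)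
      also have "\<dots> \<le> x / real n" using nfacts[OF n] by simp
      finally have *: "lo * exp 7 \<le> x / real n" .
      then show "lo \<le> x / real n / exp 7" by (simp only: pos_le_divide_eq exp_gt_zero)
      have "exp 7 = 1 * (exp 7 :: real)" by simp
      also have "\<dots> \<le> lo * exp 7" using lo1 by (intro mult_right_mono) auto
      finally show "exp 7 \<le> x / real n" using * by (rule order_trans)
    qed
    have R: "x / ln x / (2 * exp 7) * (1 / real n) \<le> real (card (?R n))" if n: "n \<in> ?W" for n
    proof -
      note nf = nfacts[OF n]
      have n1: "n \<ge> 1" using dense_window_pos[OF n] .
      define z where "z = x / real n"
      have zz: "z \<ge> exp 7" "lo \<le> z / exp 7" using z7[OF n] lower[OF n] by (simp_all add: z_def)
      have z1: "z > 1" using zz(1) by (rule less_le_trans[rotated]) simp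
      have "z / (exp 7 * ln x) \<le> z / (exp 7 * ln z)"
      proof (intro divide_left_mono mult_left_mono ln_mono)
        show "z \<le> x" using nf n1 xpos by (simp add: z_def field_simps)
      qed (use z1 L5 in auto)
      also have "\<dots> \<le> real (card (?I n))" using card_primes_interval_ge[OF zz(1)] by (simp add: z_def)
      finally have I: "z / (exp 7 * ln x) \<le> real (card (?I n))" .
      let ?P = "{p. prime p \<and> p dvd n \<and> lo < real p}"
      have finP: "finite ?P" using n1 lo1 by (rule card_large_prime_divisors)
      have "?I n \<subseteq> ?R n \<union> ?P" using zz(2) by (auto simp: z_def)
      then have "card (?I n) \<le> card (?R n \<union> ?P)" by (intro card_mono finite_UnI finR finP)
      also have "\<dots> \<le> card (?R n) + card ?P" by (rule card_Un_le)
      finally have "real (card (?I n)) \<le> real (card (?R n)) + real (card ?P)" by linarith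
      \<comment> \<open>The lower bound for \<open>card (?I n)\<close> is at least 200, so
        discarding 100 primes leaves at least half of that bound.\<close>
      moreover have "real (card ?P) \<le> 100"
      proof -
        have "real (card ?P) \<le> ln (real n) / ln lo" using n1 lo1 by (rule card_large_prime_divisors)
        also have "\<dots> \<le> ln x / ln lo" using nf lo1 by (intro divide_right_mono ln_mono) auto
        also have "\<dots> = 100" using L5 by (simp add: lnlo)
        finally show ?thesis .
      qed
      moreover have "200 * exp 7 * ln x \<le> z" using big nf by (simp add: z_def)
      then have "200 \<le> z / (exp 7 * ln x)" using L5 by (simp add: field_simps)
      moreover have "C \<le> r + P \<Longrightarrow> P \<le> 100 \<Longrightarrow> 200 \<le> w \<Longrightarrow> w \<le> C \<Longrightarrow> w / 2 \<le> r"
        for C r P w :: real by simp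
      ultimately have "z / (exp 7 * ln x) / 2 \<le> real (card (?R n))" using I by blast
      moreover have "z / (exp 7 * ln x) / 2 = x / ln x / (2 * exp 7) * (1 / real n)"
        by (simp add: z_def)
      ultimately show ?thesis by simp
    qed
    define V where "V = (SIGMA n:?W. ?R n)"
    let ?f = "\<lambda>(n, p). n * p :: nat"
    let ?T = "{n::nat. 1 \<le> n \<and> real n \<le> x \<and> strictly_2_dense n}"
    have finV: "finite V" unfolding V_def by (intro finite_SigmaI finite_dense_window finR)
    have finT: "finite ?T" by (rule finite_subset[of _ "{..nat \<lfloor>x\<rfloor>}"]) (auto simp: le_nat_floor)
    have Vfacts: "prime p \<and> lo < real p \<and> n \<ge> 1 \<and> real (n * p) \<le> x" "densely_divisible (n * p)"
      if "(n, p) \<in> V" for n p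
    proof -
      have np: "n \<in> ?W" "p \<in> ?R n" using that by (auto simp: V_def)
      note nf = nfacts[OF np(1)]
      have p: "prime p" "x / real n / exp 7 < real p" "real p \<le> x / real n" "\<not> p dvd n" using np by auto
      have "real n * real p \<le> x" using p nf by (simp add: field_simps)
      then show "prime p \<and> lo < real p \<and> n \<ge> 1 \<and> real (n * p) \<le> x"
        using p lower[OF np(1)] dense_window_pos[OF np(1)] by simp
      have "p < n" using p nf by linarith
      then show "densely_divisible (n * p)"
        using np(1) p by (intro densely_divisible_mult_prime) (auto simp: dense_window_def)
    qed
    have "x / ln x / (2 * exp 7) * c \<le> x / ln x / (2 * exp 7) * (\<Sum>n\<in>?W. 1 / real n)"
      using x0[of x] x x1 by (intro mult_left_mono divide_nonneg_nonneg mult_nonneg_nonneg) auto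
    also have "\<dots> = (\<Sum>n\<in>?W. x / ln x / (2 * exp 7) * (1 / real n))" by (rule sum_distrib_left)
    also have "\<dots> \<le> (\<Sum>n\<in>?W. real (card (?R n)))" using R by (rule sum_mono)
    also have "\<dots> = (\<Sum>n\<in>?W. \<Sum>p\<in>?R n. 1)" by simp
    also have "\<dots> = (\<Sum>(n, p)\<in>V. 1)" unfolding V_def using finR by (intro sum.Sigma) auto
    also have "\<dots> \<le> ln x / ln lo * (\<Sum>m\<in>?f ` V. 1)"
      using sum_products_le[OF finV, of lo x "\<lambda>_. 1"] Vfacts(1) lo1 by simp
    also have "\<dots> = 100 * real (card (?f ` V))" using L5 by (simp add: lnlo)
    also have "card (?f ` V) \<le> card ?T"
    proof (rule card_mono[OF finT])
      show "?f ` V \<subseteq> ?T"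
      proof
        fix m assume "m \<in> ?f ` V"
        then obtain n p where np: "(n, p) \<in> V" "m = n * p" by auto
        have "m \<ge> 1" using Vfacts(1)[OF np(1)] np(2) prime_gt_0_nat[of p] by (simp add: Suc_le_eq)
        then show "m \<in> ?T"
          using Vfacts[OF np(1)] np(2) strictly_2_dense_if_densely_divisible by blast
      qed
    qed
    then have "100 * real (card (?f ` V)) \<le> 100 * real (D' x)" by (simp add: D'_def)
    finally show ?thesis by (simp add: field_simps)
  qed
  moreover have "c / (200 * exp 7) > 0" using c by simp
  ultimately show ?thesis by blast
qed

theorem theorem5p11:
  shows "\<exists>c::real. c > 0 \<and> (\<forall>x::real. x \<ge> 2 \<longrightarrow> real (D' x) \<ge> c * (x / ln x))"
proof -
  obtain c x0 where c: "c > 0" and x0: "\<And>x. x \<ge> x0 \<Longrightarrow> c * (x / ln x) \<le> real (D' x)"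
    using D'_ge_eventually by blast
  define X where "X = max x0 2"
  \<comment> \<open>For 2 <= x < x0 the number 2 alone gives D' x >= 1, while x / ln x is at most X
    / ln 2.\<close>
  define d where "d = min c (ln 2 / X)"
  have d: "d > 0" using c by (simp add: d_def X_def)
  have "d * (x / ln x) \<le> real (D' x)" if x: "x \<ge> 2" for x
  proof (cases "x \<ge> x0")
    case True
    have "d * (x / ln x) \<le> c * (x / ln x)" using x by (intro mult_right_mono) (auto simp: d_def)
    with x0[OF True] show ?thesis by simp
  next
    case False
    have "d * (x / ln x) \<le> ln 2 / X * (X / ln 2)"
    proof (intro mult_mono frac_le)
      show "x \<le> X" using False by (simp add: X_def)
    qed (use x in \<open>auto simp: d_def X_def\<close>)
    also have "\<dots> = 1" by (simp add: X_def)
    also have "1 \<le> real (D' x)"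
    proof -
      have "finite {n::nat. 1 \<le> n \<and> real n \<le> x \<and> strictly_2_dense n}"
        by (rule finite_subset[of _ "{..nat \<lfloor>x\<rfloor>}"]) (auto simp: le_nat_floor)
      moreover have "2 \<in> {n::nat. 1 \<le> n \<and> real n \<le> x \<and> strictly_2_dense n}"
        using x densely_divisible_2 strictly_2_dense_if_densely_divisible by auto
      ultimately have "card {n::nat. 1 \<le> n \<and> real n \<le> x \<and> strictly_2_dense n} > 0"
        by (metis card_gt_0_iff empty_iff)
      then show ?thesis by (simp add: D'_def)
    qed
    finally show ?thesis .
  qed
  with d show ?thesis by blast
qed

end
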